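(* Let an explicit Runge--Kutta method of odd linear order $p$ be given, with coefficients $\alpha_0,\alpha_1,\dots,\alpha_s$ (and $\alpha_k=0$ for $k>s$). The method is strongly stable if and only if $$(-1)^{\frac{p+1}{2}}\left(\alpha_{p+1}-\frac{1}{(p+1)!}\right)<0 .$$
   Context: An explicit $s$-stage Runge--Kutta (RK) method ($s\ge 1$) applied to the linear autonomous system $\frac{d}{dt}u=Lu$, $u\in\mathbb{R}^N$, $L\in\mathbb{R}^{N\times N}$, with time step $\tau>0$ takes the form $u^{n+1}=R_s u^n$, where $R_s=\sum_{k=0}^s\alpha_k(\tau L)^k$ with real coefficients $\alpha_k$ depending only on the method, $\alpha_0=1$, $\alpha_s\ne 0$. Set $\alpha_k=0$ for $k>s$. The method has linear order $p\ge1$ if $\alpha_k=\frac1{k!}$ for $0\le k\le p$ and $\alpha_{p+1}\neq\frac{1}{(p+1)!}$ (so $p\le s$). For a real symmetric positive definite $N\times N$ matrix $H$, let $\langle v,w\rangle_H=\langle v,Hw\rangle$ ($\langle\cdot,\cdot\rangle$ the Euclidean inner product), $\|v\|_H=\sqrt{\langle v,v\rangle_H}$, and let $\|A\|_H$ be the induced operator norm of a matrix $A$. $L$ is semi-negative (with respect to $H$) if $L^\top H+HL\le 0$, i.e. is negative semi-definite. The method is strongly stable if there exists a constant $\lambda>0$ (depending only on the method) such that for all $N$, all symmetric positive definite $H\in\mathbb{R}^{N\times N}$, all $L\in\mathbb{R}^{N\times N}$ semi-negative with respect to $H$ and all $\tau>0$ with $\tau\|L\|_H\le\lambda$, one has $\|R_s\|_H\le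 1$ (equivalently $\|R_su\|_H\le\|u\|_H$ for all $u\in\mathbb{R}^N$). *)

theory Defs
  imports Complex_Main "Jordan_Normal_Form.Matrix"
begin

text \<open>
  Strong stability quantifies over all dimensions at once, so vectors and matrices are those of
  \<^theory>\<open>Jordan_Normal_Form.Matrix\<close>, whose dimension is a value rather than a type.
\<close>

definition sym_pos_def :: "nat \<Rightarrow> real mat \<Rightarrow> bool" where
  "sym_pos_def N H \<longleftrightarrow>
     H \<in> carrier_mat N N \<and> transpose_mat H = H \<and>
     (\<forall>v \<in> carrier_vec N. v \<noteq> 0\<^sub>v N \<longrightarrow> v \<bullet> (H *\<^sub>v v) > 0)"

definition neg_semidef :: "nat \<Rightarrow> real mat \<Rightarrow> bool" where
  "neg_semidef N A \<longleftrightarrow>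
     A \<in> carrier_mat N N \<and> (\<forall>v \<in> carrier_vec N. v \<bullet> (A *\<^sub>v v) \<le> 0)"

definition inner_H :: "real mat \<Rightarrow> real vec \<Rightarrow> real vec \<Rightarrow> real" where
  "inner_H H v w = v \<bullet> (H *\<^sub>v w)"

definition norm_H :: "real mat \<Rightarrow> real vec \<Rightarrow> real" where
  "norm_H H v = sqrt (inner_H H v v)"

text \<open>
  For symmetric positive definite \<open>H\<close> the set below is bounded above. The closed unit ball is used
  rather than the unit sphere so that the set is nonempty also in dimension \<open>0\<close>.
\<close>
definition opnorm_H :: "real mat \<Rightarrow> real mat \<Rightarrow> real" where
  "opnorm_H H A = Sup {norm_H H (A *\<^sub>v v) | v. v \<in> carrier_vec (dim_row H) \<and> norm_H H v \<le> 1}"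

definition semi_negative :: "nat \<Rightarrow> real mat \<Rightarrow> real mat \<Rightarrow> bool" where
  "semi_negative N H L \<longleftrightarrow>
     L \<in> carrier_mat N N \<and> neg_semidef N (transpose_mat L * H + H * L)"

text \<open>
  An explicit \<open>s\<close>-stage method enters only through the coefficients \<open>\<alpha>\<close> of its stability polynomial,
  extended by zero beyond index \<open>s\<close>.
\<close>
definition explicit_RK :: "nat \<Rightarrow> (nat \<Rightarrow> real) \<Rightarrow> bool" where
  "explicit_RK s \<alpha> \<longleftrightarrow> s \<ge> 1 \<and> \<alpha> 0 = 1 \<and> \<alpha> s \<noteq> 0 \<and> (\<forall>k>s. \<alpha> k = 0)"

definition has_linear_order :: "(nat \<Rightarrow> real) \<Rightarrow> nat \<Rightarrow> bool" where
  "has_linear_order \<alpha> p \<longleftrightarrow>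
     p \<ge> 1 \<and> (\<forall>k\<le>p. \<alpha> k = 1 / fact k) \<and> \<alpha> (p + 1) \<noteq> 1 / fact (p + 1)"

text \<open>
  The matrix \<open>R\<^sub>s = (\<Sum>k\<le>s. \<alpha> k (\<tau> L)^k)\<close>, summed entrywise since matrices of unspecified dimension
  do not form a type-class monoid.
\<close>
definition RK_matrix :: "nat \<Rightarrow> (nat \<Rightarrow> real) \<Rightarrow> nat \<Rightarrow> real \<Rightarrow> real mat \<Rightarrow> real mat" where
  "RK_matrix s \<alpha> N \<tau> L =
     mat N N (\<lambda>(i, j). \<Sum>k\<le>s. (\<alpha> k \<cdot>\<^sub>m ((\<tau> \<cdot>\<^sub>m L) ^\<^sub>m k)) $$ (i, j))"

definition strongly_stable :: "nat \<Rightarrow> (nat \<Rightarrow> real) \<Rightarrow> bool" where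
  "strongly_stable s \<alpha> \<longleftrightarrow>
     (\<exists>c>0. \<forall>N H L \<tau>.
        sym_pos_def N H \<longrightarrow> semi_negative N H L \<longrightarrow> \<tau> > 0 \<longrightarrow> \<tau> * opnorm_H H L \<le> c \<longrightarrow>
        opnorm_H H (RK_matrix s \<alpha> N \<tau> L) \<le> 1)"

end

(* Writing u_k = (tau L)^k u, the energy |R u|^2 is a combination of the products b(i,j) = <u_i, u_j>, and
   g(i,j) = -(b(i+1,j) + b(i,j+1)) is again a Gram kernel since L is semi-negative. For the exact
   exponential the energy drop is the integral of the dissipation, so that the coefficients of the
   low-order g(i,j) are those of a rescaled Hilbert matrix, which is positive definite. The defect of the
   method at order p + 1 = 2m contributes 2 (-1)^m (alpha_(p+1) - 1/(p+1)!) |u_m|^2. Both leading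
   contributions dissipate energy when the sign condition holds, and everything else is absorbed by them
   for small tau. If the sign is reversed, a plane rotation (for which g = 0) violates stability. *)
theory Submission
  imports Defs
begin

subsection \<open>Positive semidefinite kernels\<close>

text \<open>The step-size bound must serve all dimensions, norms and operators at once. The
  estimates are therefore made for abstract symmetric kernels on pairs of naturals, with constants
  computed from \<alpha> alone. Neither of the two gains suffices by itself. For a skew operator
  \<open>g\<close> vanishes and only |u_m|^2 is left. In general, a defect product of total order at
  least 2m becomes comparable with |u_m|^2 only after powers of L have been moved across until both
  indices are at least m. This costs mixed products g(i,j) whose lower index is controlled by the
  dissipation alone. They can be absorbed because g(k,k) = -2 b(k+1,k) is small against |u_m|^2 for
  k \<ge> m, and a weighted Young inequality passes this smallness on to g(i,j) as soon as one index
  is at least m.\<close>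

definition psd_kernel :: "(nat \<Rightarrow> nat \<Rightarrow> real) \<Rightarrow> bool" where
  "psd_kernel g \<longleftrightarrow>
     (\<forall>i j. g i j = g j i) \<and> (\<forall>n x. 0 \<le> (\<Sum>i<n. \<Sum>j<n. x i * x j * g i j))"

lemma psd_kernel_sym: "psd_kernel g \<Longrightarrow> g i j = g j i"
  by (simp add: psd_kernel_def)

lemma psd_kernel_nonneg: "psd_kernel g \<Longrightarrow> 0 \<le> (\<Sum>i<n. \<Sum>j<n. x i * x j * g i j)"
  by (simp add: psd_kernel_def)

lemma psd_kernel_two:
  assumes "psd_kernel g"
  shows "0 \<le> x\<^sup>2 * g i i + 2 * x * y * g i j + y\<^sup>2 * g j j"
proof -
  define n where "n = Suc (max i j)"
  \<comment> \<open>A sum of two indicators: for i = j the weights add up to x + y, as the claim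
    requires there.\<close>
  define z where "z k = (if k = i then x else 0) + (if k = j then y else 0)" for k
  have n: "i < n" "j < n" by (auto simp: n_def)
  have z: "(\<Sum>k<n. z k * h k) = x * h i + y * h j" for h
    using n by (simp add: z_def distrib_right sum.distrib if_distrib[of "\<lambda>t. t * _"] cong: if_cong)
  have "0 \<le> (\<Sum>k<n. \<Sum>l<n. z k * z l * g k l)"
    by (rule psd_kernel_nonneg[OF assms])
  also have "\<dots> = (\<Sum>k<n. z k * (\<Sum>l<n. z l * g k l))"
    by (simp add: sum_distrib_left mult.assoc)
  also have "\<dots> = x * (x * g i i + y * g i j) + y * (x * g j i + y * g j j)"
    by (simp add: z)
  also have "\<dots> = x\<^sup>2 * g i i + 2 * x * y * g i j + y\<^sup>2 * g j j"
    using psd_kernel_sym[OF assms, of j i] by (simp add: power2_eq_square algebra_simps)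
  finally show ?thesis .
qed

lemma psd_kernel_diag: "psd_kernel g \<Longrightarrow> 0 \<le> g i i"
  using psd_kernel_two[of g 1 i 0 i] by simp

text \<open>Divide the nonnegative form at \<open>(r, 1)\<close> and \<open>(r, -1)\<close> by
  \<open>r\<close>. The free weight later balances a small diagonal entry against one of moderate
  size.\<close>

lemma psd_kernel_young:
  assumes "psd_kernel g" "r > 0"
  shows "2 * \<bar>g i j\<bar> \<le> r * g i i + g j j / r"
proof -
  have "0 \<le> r * (r\<^sup>2 * g i i + 2 * r * g i j + g j j) / r\<^sup>2"
    using psd_kernel_two[OF assms(1), of r i 1 j] assms(2) by (simp add: zero_le_mult_iff)
  moreover have "0 \<le> r * (r\<^sup>2 * g i i - 2 * r * g i j + g j j) / r\<^sup>2"
    using psd_kernel_two[OF assms(1), of r i "-1" j] assms(2) by (simp add: zero_le_mult_iff)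
  moreover have "r * (r\<^sup>2 * g i i + 2 * r * t + g j j) / r\<^sup>2 = r * g i i + 2 * t + g j j / r" for t
    using assms(2) by (simp add: field_simps power2_eq_square)
  from this[of "g i j"] this[of "- g i j"] calculation show ?thesis
    by simp
qed

text \<open>Young's inequality with weight \<open>v / u\<close>, which makes both summands equal to
  \<open>u * v * w\<close>. Stating it through bounds on the diagonal avoids square roots.\<close>

lemma psd_kernel_cauchy_schwarz:
  assumes "psd_kernel g" "0 < u" "0 < v" "g i i \<le> u\<^sup>2 * w" "g j j \<le> v\<^sup>2 * w"
  shows "\<bar>g i j\<bar> \<le> u * v * w"
proof -
  have "2 * \<bar>g i j\<bar> \<le> v / u * g i i + g j j / (v / u)"
    by (rule psd_kernel_young) (use assms in auto)
  also have "\<dots> \<le> v / u * (u\<^sup>2 * w) + (v\<^sup>2 * w) / (v / u)"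
    using assms by (intro add_mono mult_left_mono divide_right_mono) auto
  also have "\<dots> = 2 * (u * v * w)"
    using assms(2,3) by (simp add: field_simps power2_eq_square)
  finally show ?thesis by simp
qed

lemma mult_le_abs_bound:
  fixes a x e :: real
  assumes "\<bar>x\<bar> \<le> e"
  shows "a * x \<le> \<bar>a\<bar> * e"
proof -
  have "a * x \<le> \<bar>a\<bar> * \<bar>x\<bar>" by (simp add: abs_mult[symmetric])
  also have "\<dots> \<le> \<bar>a\<bar> * e" using assms by (intro mult_left_mono) auto
  finally show ?thesis .
qed

text \<open>This is tr(A g) \<ge> \<kappa> tr(g) with \<kappa> independent of \<open>g\<close>.
  Instead of eigenvalues, the induction uses completion of the square: the form of \<open>A\<close>
  splits into that of a Schur complement and one squared linear form with weight
  \<open>a\<close>.\<close>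

lemma pos_def_kernel_coercive:
  fixes A :: "nat \<Rightarrow> nat \<Rightarrow> real"
  assumes "\<And>i j. A i j = A j i"
    and "\<And>x. \<exists>i<n. x i \<noteq> 0 \<Longrightarrow> 0 < (\<Sum>i<n. \<Sum>j<n. x i * x j * A i j)"
  shows "\<exists>\<kappa>>0. \<forall>g. psd_kernel g \<longrightarrow> \<kappa> * (\<Sum>i<n. g i i) \<le> (\<Sum>i<n. \<Sum>j<n. A i j * g i j)"
  using assms
proof (induction n arbitrary: A)
  case 0
  show ?case by (auto intro: exI[of _ 1])
next
  case (Suc n)
  \<comment> \<open>\<open>A'\<close> is the Schur complement of the last diagonal entry.\<close>
  define a where "a = A n n"
  define y where "y i = A i n / a" for i
  define A' where "A' i j = A i j - a * y i * y j" for i j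
  have ext: "(\<Sum>i<Suc n. \<Sum>j<Suc n. f i j) =
      (\<Sum>i<n. \<Sum>j<n. f i j) + (\<Sum>i<n. f i n) + (\<Sum>j<n. f n j) + f n n" for f :: "nat \<Rightarrow> nat \<Rightarrow> real"
    by (simp add: sum.distrib)
  have "0 < (\<Sum>i<Suc n. \<Sum>j<Suc n. (if i = n then 1 else 0) * (if j = n then 1 else 0) * A i j)"
    by (rule Suc.prems(2)) auto
  then have a: "a > 0" by (simp add: ext a_def)
  have An: "A i n = a * y i" "A n i = a * y i" for i
    using a Suc.prems(1)[of n i] by (auto simp: y_def)
  have yn: "y n = 1" using a by (simp add: y_def a_def)
  have "\<exists>\<kappa>>0. \<forall>g. psd_kernel g \<longrightarrow> \<kappa> * (\<Sum>i<n. g i i) \<le> (\<Sum>i<n. \<Sum>j<n. A' i j * g i j)"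
  proof (rule Suc.IH)
    show "A' i j = A' j i" for i j using Suc.prems(1)[of i j] by (simp add: A'_def mult.commute mult.left_commute)
  next
    fix x :: "nat \<Rightarrow> real"
    assume "\<exists>i<n. x i \<noteq> 0"
    \<comment> \<open>The last coordinate \<open>- t\<close> minimises the form of \<open>A\<close>
      over that coordinate; what remains is the form of \<open>A'\<close> at
      \<open>x\<close>.\<close>
    define t where "t = (\<Sum>i<n. x i * y i)"
    define z where "z i = (if i < n then x i else - t)" for i
    have "0 < (\<Sum>i<Suc n. \<Sum>j<Suc n. z i * z j * A i j)"
      using \<open>\<exists>i<n. x i \<noteq> 0\<close> by (intro Suc.prems(2)) (auto simp: z_def intro: less_SucI)
    also have "\<dots> = (\<Sum>i<n. \<Sum>j<n. x i * x j * A i j) + (\<Sum>i<n. x i * (- t) * A i n)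
        + (\<Sum>j<n. (- t) * x j * A n j) + (- t) * (- t) * a"
      unfolding ext by (simp add: z_def a_def)
    also have "(\<Sum>i<n. x i * (- t) * A i n) = - (a * t * t)"
      by (simp add: An t_def sum_distrib_left sum_distrib_right sum_negf mult_ac)
    also have "(\<Sum>j<n. (- t) * x j * A n j) = - (a * t * t)"
      by (simp add: An t_def sum_distrib_left sum_distrib_right sum_negf mult_ac)
    also have "(\<Sum>i<n. \<Sum>j<n. x i * x j * A i j) = (\<Sum>i<n. \<Sum>j<n. x i * x j * A' i j) + a * t * t"
    proof -
      have "a * t * t = (\<Sum>i<n. \<Sum>j<n. x i * x j * (a * y i * y j))"
        unfolding t_def mult.assoc by (simp add: sum_product sum_distrib_left mult_ac)
      then show ?thesis
        by (simp add: A'_def right_diff_distrib sum_subtractf)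
    qed
    finally show "0 < (\<Sum>i<n. \<Sum>j<n. x i * x j * A' i j)" by simp
  qed
  then obtain \<kappa> where \<kappa>: "\<kappa> > 0"
    "\<And>g. psd_kernel g \<Longrightarrow> \<kappa> * (\<Sum>i<n. g i i) \<le> (\<Sum>i<n. \<Sum>j<n. A' i j * g i j)"
    by blast
  define C where "C = (\<Sum>i<n. \<Sum>j<n. \<bar>y i * y j\<bar>)"
  have C: "C \<ge> 0" by (auto simp: C_def intro!: sum_nonneg)
  \<comment> \<open>The two bounds give \<open>\<mu> * (1 + 2 * C) \<le> \<kappa>\<close> and
    \<open>2 * \<mu> \<le> a\<close>.\<close>
  define \<mu> where "\<mu> = min (\<kappa> / (1 + 2 * C)) (a / 2)"
  have "\<mu> > 0" using \<kappa> a C by (simp add: \<mu>_def)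
  moreover have "\<mu> * (\<Sum>i<Suc n. g i i) \<le> (\<Sum>i<Suc n. \<Sum>j<Suc n. A i j * g i j)"
    if g: "psd_kernel g" for g
  proof -
    define G where "G = (\<Sum>i<n. g i i)"
    define S where "S = (\<Sum>i<n. \<Sum>j<n. y i * y j * g i j)"
    define T where "T = (\<Sum>i<n. y i * g i n)"
    have gd: "0 \<le> g k k" for k by (rule psd_kernel_diag[OF g])
    have G0: "G \<ge> 0" by (auto simp: G_def intro!: sum_nonneg gd)
    have le_G: "g i i \<le> G" if "i < n" for i
      unfolding G_def using that by (intro member_le_sum) (auto intro: gd)
    have quad: "(\<Sum>i<Suc n. \<Sum>j<Suc n. z i * z j * g i j) = r\<^sup>2 * S + 2 * r * T + g n n"
      if z: "\<And>i. i < n \<Longrightarrow> z i = r * y i" "z n = 1" for z r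
    proof -
      have "(\<Sum>i<n. \<Sum>j<n. z i * z j * g i j) = r\<^sup>2 * S"
        by (simp add: z S_def sum_distrib_left power2_eq_square mult_ac)
      moreover have "(\<Sum>i<n. z i * z n * g i n) = r * T" "(\<Sum>j<n. z n * z j * g n j) = r * T"
        using psd_kernel_sym[OF g] by (simp_all add: z T_def sum_distrib_left mult_ac)
      ultimately show ?thesis unfolding ext using z by simp
    qed
    have "0 \<le> (\<Sum>i<Suc n. \<Sum>j<Suc n. y i * y j * g i j)"
      by (rule psd_kernel_nonneg[OF g])
    also have "\<dots> = S + 2 * T + g n n" by (subst quad[of _ 1]) (auto simp: yn)
    finally have Q: "0 \<le> S + 2 * T + g n n" .
    \<comment> \<open>For Gram vectors u_i and Y the sum of the y_i u_i with i < n, this is |u_n|^2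
      \<le> 2 |u_n + Y|^2 + 2 |Y|^2, written as |2 Y + u_n|^2 \<ge> 0.\<close>
    have "0 \<le> (\<Sum>i<Suc n. \<Sum>j<Suc n. (if i < n then 2 * y i else 1) * (if j < n then 2 * y j else 1) * g i j)"
      by (rule psd_kernel_nonneg[OF g, where x = "\<lambda>i. if i < n then 2 * y i else 1"])
    also have "\<dots> = 4 * S + 4 * T + g n n" by (subst quad[of _ 2]) auto
    finally have gnn: "g n n \<le> 2 * (S + 2 * T + g n n) + 2 * S" by simp
    have "S \<le> (\<Sum>i<n. \<Sum>j<n. \<bar>y i * y j\<bar> * G)"
      unfolding S_def
    proof (intro sum_mono)
      fix i j assume "i \<in> {..<n}" "j \<in> {..<n}"
      then have "\<bar>g i j\<bar> \<le> G"
        using psd_kernel_young[OF g, of 1 i j] le_G[of i] le_G[of j] by simp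
      then show "y i * y j * g i j \<le> \<bar>y i * y j\<bar> * G"
        by (rule mult_le_abs_bound)
    qed
    also have "\<dots> = C * G" by (simp add: C_def sum_distrib_right)
    finally have SC: "S \<le> C * G" .
    have "\<mu> * (\<Sum>i<Suc n. g i i) = \<mu> * (G + g n n)" by (simp add: G_def)
    also have "\<dots> \<le> \<mu> * (G + (2 * (S + 2 * T + g n n) + 2 * (C * G)))"
      using \<open>\<mu> > 0\<close> gnn SC by (intro mult_left_mono) auto
    also have "\<dots> = \<mu> * ((1 + 2 * C) * G) + (2 * \<mu>) * (S + 2 * T + g n n)"
      by (simp add: algebra_simps)
    also have "\<dots> \<le> \<kappa> * G + a * (S + 2 * T + g n n)"
    proof (intro add_mono)
      have "\<mu> * (1 + 2 * C) \<le> \<kappa>"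
        using C by (simp add: \<mu>_def pos_le_divide_eq[symmetric])
      then show "\<mu> * ((1 + 2 * C) * G) \<le> \<kappa> * G"
        using G0 by (metis mult.assoc mult_right_mono)
      show "2 * \<mu> * (S + 2 * T + g n n) \<le> a * (S + 2 * T + g n n)"
        using Q by (intro mult_right_mono) (auto simp: \<mu>_def)
    qed
    also have "\<dots> \<le> (\<Sum>i<n. \<Sum>j<n. A' i j * g i j) + a * (S + 2 * T + g n n)"
      using \<kappa>(2)[OF g] by (simp add: G_def)
    also have "\<dots> = (\<Sum>i<Suc n. \<Sum>j<Suc n. A i j * g i j)"
    proof -
      have "(\<Sum>i<n. \<Sum>j<n. A' i j * g i j) = (\<Sum>i<n. \<Sum>j<n. A i j * g i j) - a * S"
        by (simp add: A'_def S_def left_diff_distrib sum_subtractf sum_distrib_left mult.assoc)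
      moreover have "(\<Sum>i<n. A i n * g i n) = a * T" "(\<Sum>j<n. A n j * g n j) = a * T"
        using psd_kernel_sym[OF g] by (simp_all add: An T_def sum_distrib_left mult.assoc)
      ultimately show ?thesis
        unfolding ext by (simp add: algebra_simps a_def)
    qed
    finally show ?thesis .
  qed
  ultimately show ?case by blast
qed

text \<open>The form is the integral over [0, 1] of the square of the polynomial with coefficients
  \<open>x\<close>, handled through the antiderivative \<open>F\<close>. If \<open>F 1 = 0\<close>,
  monotonicity makes \<open>F\<close> vanish on the interval, so the polynomial has infinitely many
  roots although some coefficient is nonzero.\<close>

lemma hilbert_matrix_pos_def:
  fixes x :: "nat \<Rightarrow> real"
  assumes "\<exists>i<n. x i \<noteq> 0"
  shows "0 < (\<Sum>i<n. \<Sum>j<n. x i * x j / real (i + j + 1))"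
proof -
  define f where "f t = (\<Sum>i<n. x i * t ^ i)" for t
  define F where "F t = (\<Sum>i<n. \<Sum>j<n. x i * x j / real (i + j + 1) * t ^ (i + j + 1))" for t
  have der: "(F has_real_derivative (f t)\<^sup>2) (at t)" for t
  proof -
    have "(F has_real_derivative (\<Sum>i<n. \<Sum>j<n. x i * x j * t ^ (i + j))) (at t)"
      unfolding F_def
      by (auto intro!: derivative_eq_intros sum.cong simp del: of_nat_Suc power_Suc)
    moreover have "(\<Sum>i<n. \<Sum>j<n. x i * x j * t ^ (i + j)) = (f t)\<^sup>2"
      by (simp add: f_def power2_eq_square sum_product power_add mult_ac)
    ultimately show ?thesis by simp
  qed
  have mono: "F u \<le> F v" if "u \<le> v" for u v
    by (rule DERIV_nonneg_imp_nondecreasing[OF that]) (use der in \<open>auto intro!: exI\<close>)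
  have F0: "F 0 = 0" by (simp add: F_def)
  have "F 1 \<noteq> 0"
  proof
    assume F1: "F 1 = 0"
    have zero: "F t = 0" if "0 < t" "t < 1" for t
      using mono[of 0 t] mono[of t 1] F0 F1 that by simp
    have "f t = 0" if t: "t \<in> {0<..<1}" for t
    proof -
      have "((\<lambda>_. 0) has_real_derivative (f t)\<^sup>2) (at t)"
        by (rule has_field_derivative_transform_within_open[OF der open_greaterThanLessThan t])
          (use zero in auto)
      then have "(f t)\<^sup>2 = 0" by (rule DERIV_unique) simp
      then show ?thesis by simp
    qed
    moreover obtain k where k: "n = Suc k" using assms by (cases n) auto
    ultimately have "{0<..<1} \<subseteq> {t. (\<Sum>i\<le>k. x i * t ^ i) = 0}"
      by (auto simp: f_def lessThan_Suc_atMost)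
    then have "\<not> finite {t. (\<Sum>i\<le>k. x i * t ^ i) = 0}"
      by (rule infinite_super) (simp add: infinite_Ioo)
    then show False using assms polyfun_finite_roots[of x k] by (auto simp: k less_Suc_eq_le)
  qed
  with mono[of 0 1] F0 have "0 < F 1" by simp
  then show ?thesis by (simp add: F_def)
qed

subsection \<open>Energy estimates for kernels\<close>

lemma sum_symmetrize:
  fixes f :: "nat \<Rightarrow> nat \<Rightarrow> real"
  shows "(\<Sum>i\<le>s. \<Sum>j\<le>s. f i j + f j i) = 2 * (\<Sum>i\<le>s. \<Sum>j\<le>s. f i j)"
  using sum.swap[of f "{..s}" "{..s}"] by (simp add: sum.distrib)

lemma sum_delta2:
  fixes c :: real and p s :: nat
  assumes "p \<le> s"
  shows "(\<Sum>i\<le>s. \<Sum>j\<le>s. if i = p then if j = 0 then c else 0 else 0) = c"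
proof -
  have "(\<Sum>j\<le>s. if i = p then if j = 0 then c else 0 else 0) = (if i = p then c else 0)" for i
    by simp
  then show ?thesis using assms by simp
qed

text \<open>
  Every \<open>\<alpha> i * \<alpha> j * b i j\<close> with \<open>i + j > 0\<close> is split with the weights \<open>i / (i + j)\<close> and
  \<open>j / (i + j)\<close>, which amounts to integrating the derivative of \<open>|\<Sum>i\<le>s. \<alpha> i * t ^ i * u i|\<^sup>2\<close>
  over \<open>[0, 1]\<close>; the last sum collects the failure of \<open>\<alpha>\<close> to satisfy the exponential recurrence.
\<close>
lemma energy_identity:
  fixes b :: "nat \<Rightarrow> nat \<Rightarrow> real"
  assumes sym: "\<And>i j. b i j = b j i" and "\<alpha> (Suc s) = 0"
  shows "(\<Sum>i\<le>s. \<Sum>j\<le>s. \<alpha> i * \<alpha> j * b i j) =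
    (\<alpha> 0)\<^sup>2 * b 0 0
    + (\<Sum>i\<le>s. \<Sum>j\<le>s. \<alpha> i * \<alpha> j / real (i + j + 1) * (b (Suc i) j + b i (Suc j)))
    + (\<Sum>i\<le>s. \<Sum>j\<le>s. 2 * (real (Suc i) * \<alpha> (Suc i) - \<alpha> i) * \<alpha> j / real (i + j + 1) * b (Suc i) j)"
proof -
  \<comment> \<open>The half of the split weighted by the first index; the other half is its mirror
    image. At i = j = 0 the weight is 0 / 0 = 0, so the constant term is accounted for
    separately.\<close>
  define f where "f i = (\<Sum>j\<le>s. real i * \<alpha> i * \<alpha> j / real (i + j) * b i j)" for i
  have "(\<Sum>i\<le>s. \<Sum>j\<le>s. \<alpha> i * \<alpha> j / real (i + j + 1) * (b (Suc i) j + b i (Suc j)))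
    = (\<Sum>i\<le>s. \<Sum>j\<le>s. \<alpha> i * \<alpha> j / real (i + j + 1) * b (Suc i) j
        + \<alpha> j * \<alpha> i / real (j + i + 1) * b (Suc j) i)"
    by (intro sum.cong refl) (simp add: sym[of _ "Suc _"] algebra_simps add_divide_distrib)
  also have "\<dots> = (\<Sum>i\<le>s. \<Sum>j\<le>s. 2 * (\<alpha> i * \<alpha> j / real (i + j + 1) * b (Suc i) j))"
    by (subst sum_symmetrize) (simp add: sum_distrib_left)
  finally have sym_part: "(\<Sum>i\<le>s. \<Sum>j\<le>s. \<alpha> i * \<alpha> j / real (i + j + 1) * (b (Suc i) j + b i (Suc j)))
    = (\<Sum>i\<le>s. \<Sum>j\<le>s. 2 * (\<alpha> i * \<alpha> j / real (i + j + 1) * b (Suc i) j))" .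
  have "(\<Sum>i\<le>s. \<Sum>j\<le>s. \<alpha> i * \<alpha> j / real (i + j + 1) * (b (Suc i) j + b i (Suc j)))
    + (\<Sum>i\<le>s. \<Sum>j\<le>s. 2 * (real (Suc i) * \<alpha> (Suc i) - \<alpha> i) * \<alpha> j / real (i + j + 1) * b (Suc i) j)
    = 2 * (\<Sum>i\<le>s. f (Suc i))"
    unfolding sym_part f_def sum_distrib_left sum.distrib[symmetric]
    by (intro sum.cong refl) (simp add: field_simps del: of_nat_Suc)
  \<comment> \<open>The shift is free at both ends: \<open>f 0\<close> carries the factor 0 and
    \<open>f (Suc s)\<close> the factor \<open>\<alpha> (Suc s)\<close>.\<close>
  also have "(\<Sum>i\<le>s. f (Suc i)) = (\<Sum>i\<le>s. f i)"
  proof -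
    have "f 0 = 0" "f (Suc s) = 0" using assms(2) by (simp_all add: f_def)
    then show ?thesis using sum.atMost_Suc_shift[of f s] by simp
  qed
  also have "2 * (\<Sum>i\<le>s. f i) = (\<Sum>i\<le>s. \<Sum>j\<le>s. real i * \<alpha> i * \<alpha> j / real (i + j) * b i j
      + real j * \<alpha> j * \<alpha> i / real (j + i) * b j i)"
    unfolding f_def by (subst sum_symmetrize) simp
  also have "\<dots> = (\<Sum>i\<le>s. \<Sum>j\<le>s. \<alpha> i * \<alpha> j * b i j - (if i = 0 then if j = 0 then (\<alpha> 0)\<^sup>2 * b 0 0 else 0 else 0))"
  proof (intro sum.cong refl)
    fix i j
    show "real i * \<alpha> i * \<alpha> j / real (i + j) * b i j + real j * \<alpha> j * \<alpha> i / real (j + i) * b j i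
      = \<alpha> i * \<alpha> j * b i j - (if i = 0 then if j = 0 then (\<alpha> 0)\<^sup>2 * b 0 0 else 0 else 0)"
    proof (cases "i = 0 \<and> j = 0")
      case True
      then show ?thesis by (simp add: power2_eq_square)
    next
      case False
      then have "real i + real j \<noteq> 0" by linarith
      then have "real i * \<alpha> i * \<alpha> j / real (i + j) * b i j + real j * \<alpha> j * \<alpha> i / real (j + i) * b j i
        = \<alpha> i * \<alpha> j * b i j"
      proof -
        define n where "n = real (i + j)"
        have n: "n \<noteq> 0" "real j = n - real i" "real (j + i) = n"
          using \<open>real i + real j \<noteq> 0\<close> by (simp_all add: n_def)
        show ?thesis
          unfolding n_def[symmetric] n(2,3) using n(1) by (simp add: sym[of j i] field_simps)
      qed
      then show ?thesis using False by auto
    qed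
  qed
  also have "\<dots> = (\<Sum>i\<le>s. \<Sum>j\<le>s. \<alpha> i * \<alpha> j * b i j) - (\<alpha> 0)\<^sup>2 * b 0 0"
    by (simp only: sum_subtractf sum_delta2[OF le0])
  finally show ?thesis by simp
qed

text \<open>Summation by parts, \<open>r\<close> times: each step moves one application of the
  operator to the other argument, flips the sign and leaves one dissipation term. The first index of
  these terms stays at least \<open>a\<close>, which later makes them small.\<close>

lemma kernel_shift:
  fixes b :: "nat \<Rightarrow> nat \<Rightarrow> real"
  assumes "\<And>i j. b (Suc i) j + b i (Suc j) = - g i j"
  shows "b (a + r) j = (- 1) ^ r * b a (j + r) - (\<Sum>q<r. (- 1) ^ q * g (a + (r - 1 - q)) (j + q))"
proof (induction r arbitrary: j)
  case (Suc r)
  have "b (a + Suc r) j = - g (a + r) j - b (a + r) (Suc j)"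
    using assms[of "a + r" j] by simp
  then show ?case
    unfolding Suc.IH sum.lessThan_Suc_shift by (simp add: sum_negf)
qed simp

text \<open>Exponential coefficients satisfy (i + 1) \<alpha>_(i+1) = \<alpha>_i, so the last sum of
  \<open>energy_identity\<close> starts only at i = p.\<close>

lemma linear_order_defect:
  assumes "has_linear_order \<alpha> p"
  shows "i < p \<Longrightarrow> real (Suc i) * \<alpha> (Suc i) - \<alpha> i = 0"
    and "real (Suc p) * \<alpha> (Suc p) - \<alpha> p = real (Suc p) * (\<alpha> (Suc p) - 1 / fact (Suc p))"
  using assms by (simp_all add: has_linear_order_def right_diff_distrib del: of_nat_Suc)

lemma linear_order_le_stages:
  assumes "explicit_RK s \<alpha>" "has_linear_order \<alpha> p"
  shows "p \<le> s"
  using assms unfolding explicit_RK_def has_linear_order_def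
  by (metis fact_nonzero inverse_eq_divide linorder_not_less order_refl inverse_zero_imp_zero)

text \<open>Let G be the dissipation on the diagonal below m and B = \<open>b m m\<close>. In the
  energy identity the dissipation sum gains \<kappa> G and the leading defect gains \<eta> B, up to
  errors of at most C \<epsilon> (G + B) in total. Since \<kappa>, \<eta> and C depend only on the
  method, so does \<epsilon>.\<close>

lemma energy_decay:
  assumes RK: "explicit_RK s \<alpha>" and ord: "has_linear_order \<alpha> p" and p: "Suc p = 2 * m"
    and neg: "(- 1) ^ m * (\<alpha> (Suc p) - 1 / fact (Suc p)) < 0"
  shows "\<exists>\<epsilon>>0. \<forall>b g. psd_kernel b \<longrightarrow> psd_kernel g \<longrightarrow>
    (\<forall>i j. b (Suc i) j + b i (Suc j) = - g i j) \<longrightarrow> (\<forall>i. b (Suc i) (Suc i) \<le> \<epsilon> ^ 4 * b i i) \<longrightarrow>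
    (\<Sum>i\<le>s. \<Sum>j\<le>s. \<alpha> i * \<alpha> j * b i j) \<le> b 0 0"
proof -
  define A where "A i j = \<alpha> i * \<alpha> j / real (i + j + 1)" for i j
  define w where "w i j = 2 * (real (Suc i) * \<alpha> (Suc i) - \<alpha> i) * \<alpha> j / real (i + j + 1)" for i j
  define \<eta> where "\<eta> = - 2 * (- 1) ^ m * (\<alpha> (Suc p) - 1 / fact (Suc p))"
  \<comment> \<open>Every \<open>g\<close> with an index at least \<open>m\<close> will be bounded
    by \<open>2 * E\<close>, hence the first factor 2; the second factor counts \<open>m\<close>
    such terms from an index shift and one further error \<open>E\<close>.\<close>
  define C where "C = 2 * (\<Sum>i\<le>s. \<Sum>j\<le>s. \<bar>A i j\<bar>) + (1 + 2 * real m) * (\<Sum>i\<le>s. \<Sum>j\<le>s. \<bar>w i j\<bar>)"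
  have m: "0 < m" "m \<le> p" "p \<le> s"
    using p linear_order_le_stages[OF RK ord] by auto
  have \<eta>: "\<eta> > 0" using neg by (simp add: \<eta>_def)
  have C: "C \<ge> 0" unfolding C_def by (intro add_nonneg_nonneg mult_nonneg_nonneg sum_nonneg) auto
  have \<alpha>: "\<alpha> 0 = 1" "\<alpha> (Suc s) = 0" using RK by (auto simp: explicit_RK_def)
  have wp: "w p 0 = 2 * (\<alpha> (Suc p) - 1 / fact (Suc p))"
    unfolding w_def linear_order_defect(2)[OF ord] by (simp add: \<alpha> del: of_nat_Suc fact_Suc)
  have "\<exists>\<kappa>>0. \<forall>g. psd_kernel g \<longrightarrow> \<kappa> * (\<Sum>i<m. g i i) \<le> (\<Sum>i<m. \<Sum>j<m. A i j * g i j)"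
  proof (rule pos_def_kernel_coercive)
    show "A i j = A j i" for i j by (simp add: A_def add.commute mult.commute)
    fix x :: "nat \<Rightarrow> real"
    assume x: "\<exists>i<m. x i \<noteq> 0"
    have "\<alpha> i \<noteq> 0" if "i < m" for i using ord m that by (simp add: has_linear_order_def)
    then have "0 < (\<Sum>i<m. \<Sum>j<m. (x i * \<alpha> i) * (x j * \<alpha> j) / real (i + j + 1))"
      using x by (intro hilbert_matrix_pos_def) auto
    then show "0 < (\<Sum>i<m. \<Sum>j<m. x i * x j * A i j)"
      by (simp add: A_def mult_ac)
  qed
  then obtain \<kappa> where \<kappa>: "\<kappa> > 0"
    "\<And>g. psd_kernel g \<Longrightarrow> \<kappa> * (\<Sum>i<m. g i i) \<le> (\<Sum>i<m. \<Sum>j<m. A i j * g i j)"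
    by blast
  \<comment> \<open>This puts \<open>C * \<epsilon>\<close> below both \<kappa> and \<eta>; the cap
    at 1 lets higher powers of \<epsilon> be discarded.\<close>
  define \<epsilon> where "\<epsilon> = min 1 (min \<kappa> \<eta> / (1 + C))"
  have \<epsilon>: "0 < \<epsilon>" "\<epsilon> \<le> 1" using \<kappa> \<eta> C by (auto simp: \<epsilon>_def)
  have "\<epsilon> * (1 + C) \<le> min \<kappa> \<eta>"
    using C by (simp add: \<epsilon>_def pos_le_divide_eq[symmetric] del: min_le_iff_disj min.bounded_iff)
  then have \<epsilon>C: "C * \<epsilon> \<le> \<kappa>" "C * \<epsilon> \<le> \<eta>" using \<epsilon> by (auto simp: algebra_simps)
  have \<epsilon>4: "\<epsilon> ^ 4 \<le> 1" "\<epsilon>\<^sup>2 \<le> \<epsilon>" "\<epsilon>\<^sup>2 \<le> 1"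
    using \<epsilon> by (simp_all add: power_le_one) (simp add: power2_eq_square mult_left_le)
  have "(\<Sum>i\<le>s. \<Sum>j\<le>s. \<alpha> i * \<alpha> j * b i j) \<le> b 0 0"
    if b: "psd_kernel b" and g: "psd_kernel g" and bg: "\<And>i j. b (Suc i) j + b i (Suc j) = - g i j"
      and contr: "\<And>i. b (Suc i) (Suc i) \<le> \<epsilon> ^ 4 * b i i" for b g
  proof -
    define B where "B = b m m"
    define G where "G = (\<Sum>i<m. g i i)"
    define E where "E = \<epsilon> * (G + B)"
    have b0: "0 \<le> b i i" and g0: "0 \<le> g i i" for i
      using psd_kernel_diag b g by auto
    have B: "B \<ge> 0" and G: "G \<ge> 0"
      by (auto simp: B_def G_def b0 g0 intro!: sum_nonneg)
    have E: "\<epsilon> * B \<le> E" "0 \<le> E" using B G \<epsilon> by (auto simp: E_def)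
    have bdec: "b (m + k) (m + k) \<le> B" for k
    proof (induction k)
      case (Suc k)
      have "b (m + Suc k) (m + Suc k) \<le> \<epsilon> ^ 4 * b (m + k) (m + k)" using contr[of "m + k"] by simp
      also have "\<dots> \<le> b (m + k) (m + k)" using \<epsilon> \<epsilon>4 b0 by (intro mult_left_le_one_le) auto
      finally show ?case using Suc.IH by simp
    qed (simp add: B_def)
    have bdec': "b (Suc (m + k)) (Suc (m + k)) \<le> (\<epsilon>\<^sup>2)\<^sup>2 * B" for k
    proof -
      have "b (Suc (m + k)) (Suc (m + k)) \<le> \<epsilon> ^ 4 * b (m + k) (m + k)" by (rule contr)
      also have "\<dots> \<le> \<epsilon> ^ 4 * B" using bdec \<epsilon> by (intro mult_left_mono) auto
      finally show ?thesis by simp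
    qed
    have bsmall: "\<bar>b (Suc (m + x)) (m + y)\<bar> \<le> \<epsilon>\<^sup>2 * B" for x y
      using psd_kernel_cauchy_schwarz[OF b, of "\<epsilon>\<^sup>2" 1 "Suc (m + x)" B "m + y"] bdec' bdec \<epsilon> by simp
    \<comment> \<open>The kernel relation at equal indices: from order m on, the dissipation is
      twice a product of consecutive vectors and inherits its smallness.\<close>
    have gdiag: "g (m + k) (m + k) \<le> 2 * \<epsilon>\<^sup>2 * B" for k
      using bg[of "m + k" "m + k"] bsmall[of k k] psd_kernel_sym[OF b, of "m + k" "Suc (m + k)"] by simp
    have gall: "g k k \<le> G + 2 * B" for k
    proof (cases "k < m")
      case True
      then have "g k k \<le> G" unfolding G_def by (intro member_le_sum) (auto simp: g0)
      then show ?thesis using B by simp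
    next
      case False
      then have "g k k \<le> 2 * \<epsilon>\<^sup>2 * B" using gdiag[of "k - m"] by simp
      also have "\<dots> \<le> 2 * B" using \<epsilon>4(3) B by (simp add: mult_left_le_one_le)
      finally show ?thesis using G by simp
    qed
    have gsmall: "\<bar>g (m + x) k\<bar> \<le> 2 * E" for x k
    proof -
      \<comment> \<open>The weight 1 / \<epsilon> balances an entry of size \<epsilon>^2 B against
        one that is merely bounded, leaving order \<epsilon> in both.\<close>
      have "2 * \<bar>g (m + x) k\<bar> \<le> 1 / \<epsilon> * g (m + x) (m + x) + g k k / (1 / \<epsilon>)"
        by (rule psd_kernel_young[OF g]) (use \<epsilon> in auto)
      also have "\<dots> \<le> 1 / \<epsilon> * (2 * \<epsilon>\<^sup>2 * B) + (G + 2 * B) / (1 / \<epsilon>)"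
        using \<epsilon> gdiag gall by (intro add_mono mult_left_mono divide_right_mono) auto
      also have "\<dots> = \<epsilon> * G + 4 * (\<epsilon> * B)"
        using \<epsilon> by (simp add: field_simps power2_eq_square)
      also have "\<dots> \<le> 4 * E" using \<epsilon> G B by (simp add: E_def algebra_simps)
      finally show ?thesis by simp
    qed
    have gsmall': "\<bar>g i j\<bar> \<le> 2 * E" if "m \<le> i \<or> m \<le> j" for i j
      using gsmall[of "i - m" j] gsmall[of "j - m" i] that psd_kernel_sym[OF g, of i j] by auto
    \<comment> \<open>The first index is at least 2m, so m applications can be moved across with
      both indices ending at m or more; each dissipation term on the way has first index at least
      m.\<close>
    have shift: "\<bar>b (Suc (p + x)) j - (- 1) ^ m * b (m + x) (j + m)\<bar> \<le> 2 * real m * E" for x j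
    proof -
      have "m + x + m = Suc (p + x)" using p by simp
      with kernel_shift[of b g "m + x" m j, OF bg]
      have "b (Suc (p + x)) j = (- 1) ^ m * b (m + x) (j + m)
          - (\<Sum>q<m. (- 1) ^ q * g (m + (x + (m - 1 - q))) (j + q))"
        by (simp only: add.assoc)
      then have "b (Suc (p + x)) j - (- 1) ^ m * b (m + x) (j + m) =
          - (\<Sum>q<m. (- 1) ^ q * g (m + (x + (m - 1 - q))) (j + q))"
        by linarith
      then have "\<bar>b (Suc (p + x)) j - (- 1) ^ m * b (m + x) (j + m)\<bar>
          \<le> (\<Sum>q<m. \<bar>(- 1) ^ q * g (m + (x + (m - 1 - q))) (j + q)\<bar>)"
        using sum_abs by (simp only: abs_minus_cancel)
      also have "\<dots> \<le> (\<Sum>q<m. 2 * E)"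
        by (intro sum_mono) (simp only: abs_mult power_abs abs_minus_cancel abs_one power_one mult_1 gsmall)
      finally show ?thesis by (simp add: mult_ac)
    qed
    have main: "(\<Sum>i\<le>s. \<Sum>j\<le>s. \<alpha> i * \<alpha> j * b i j) =
      b 0 0 - (\<Sum>i\<le>s. \<Sum>j\<le>s. A i j * g i j) + (\<Sum>i\<le>s. \<Sum>j\<le>s. w i j * b (Suc i) j)"
      using energy_identity[of b \<alpha> s, OF psd_kernel_sym[OF b] \<alpha>(2)]
      by (simp add: bg A_def w_def \<alpha>(1) sum_negf del: of_nat_Suc)
    have "\<kappa> * G \<le> (\<Sum>i<m. \<Sum>j<m. A i j * g i j)"
      using \<kappa>(2)[OF g] by (simp add: G_def)
    also have "\<dots> = (\<Sum>i\<le>s. if i < m then \<Sum>j\<le>s. if j < m then A i j * g i j else 0 else 0)"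
    proof -
      have "(\<Sum>i\<le>s. if i < m then h i else 0) = (\<Sum>i<m. h i)" for h :: "nat \<Rightarrow> real"
        by (rule sum.mono_neutral_cong_right) (use m in auto)
      then show ?thesis by simp
    qed
    \<comment> \<open>Completes the low block to the full sum: a term outside it may be negative,
      but not below \<open>- \<bar>A i j\<bar> * 2 * E\<close>.\<close>
    also have "\<dots> \<le> (\<Sum>i\<le>s. \<Sum>j\<le>s. A i j * g i j + \<bar>A i j\<bar> * (2 * E))"
    proof -
      have *: "- (A i j * g i j) \<le> \<bar>A i j\<bar> * (2 * E)" if "m \<le> i \<or> m \<le> j" for i j
        using mult_le_abs_bound[of "- g i j" "2 * E" "A i j"] gsmall'[OF that] by simp
      have "(if i < m then \<Sum>j\<le>s. if j < m then A i j * g i j else 0 else 0) =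
          (\<Sum>j\<le>s. if i < m \<and> j < m then A i j * g i j else 0)" for i
        by simp
      moreover have "(if i < m \<and> j < m then A i j * g i j else 0) \<le> A i j * g i j + \<bar>A i j\<bar> * (2 * E)" for i j
        using *[of i j] E by (auto simp: not_less)
      ultimately show ?thesis by (simp only:) (intro sum_mono)
    qed
    also have "\<dots> = (\<Sum>i\<le>s. \<Sum>j\<le>s. A i j * g i j) + 2 * (\<Sum>i\<le>s. \<Sum>j\<le>s. \<bar>A i j\<bar>) * E"
      by (simp add: sum.distrib sum_distrib_left sum_distrib_right mult_ac)
    finally have part1: "\<kappa> * G \<le> (\<Sum>i\<le>s. \<Sum>j\<le>s. A i j * g i j) + 2 * (\<Sum>i\<le>s. \<Sum>j\<le>s. \<bar>A i j\<bar>) * E" .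
    have term2: "w i j * b (Suc i) j \<le> (if i = p then if j = 0 then - \<eta> * B else 0 else 0)
        + \<bar>w i j\<bar> * ((1 + 2 * real m) * E)" for i j
    proof (cases "i < p")
      case True
      then show ?thesis using linear_order_defect(1)[OF ord True] by (simp add: w_def del: of_nat_Suc)
    next
      case False
      define x where "x = i - p"
      have i: "i = p + x" using False by (simp add: x_def)
      \<comment> \<open>Among the shifted products only |u_m|^2 itself is not small;
        \<open>h\<close> isolates it, and its weight produces \<open>- \<eta> * B\<close>.\<close>
      define h where "h = (if x = 0 \<and> j = 0 then (- 1) ^ m * B else 0)"
      have "\<bar>(- 1) ^ m * b (m + x) (j + m) - h\<bar> \<le> E"
      proof (cases "x = 0 \<and> j = 0")
        case True
        then show ?thesis using E by (simp add: h_def B_def)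
      next
        case False
        have "\<bar>b (m + x) (m + j)\<bar> \<le> \<epsilon>\<^sup>2 * B"
        proof (cases x)
          case 0
          then obtain y where "j = Suc y" using False by (cases j) auto
          then show ?thesis
            using bsmall[of y x] psd_kernel_sym[OF b, of "m + x" "m + j"] by simp
        next
          case (Suc x')
          then show ?thesis using bsmall[of x' j] by simp
        qed
        also have "\<dots> \<le> \<epsilon> * B" using \<epsilon>4 B by (intro mult_right_mono)
        finally show ?thesis using False E by (auto simp: h_def abs_mult power_abs add.commute)
      qed
      then have "\<bar>b (Suc i) j - h\<bar> \<le> (1 + 2 * real m) * E"
        using shift[of x j] by (simp add: i algebra_simps)
      then have "w i j * (b (Suc i) j - h) \<le> \<bar>w i j\<bar> * ((1 + 2 * real m) * E)"
        by (rule mult_le_abs_bound)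
      moreover have "w i j * h = (if i = p then if j = 0 then - \<eta> * B else 0 else 0)"
        by (auto simp: h_def i wp \<eta>_def simp del: fact_Suc)
      ultimately show ?thesis by (simp add: algebra_simps)
    qed
    have "(\<Sum>i\<le>s. \<Sum>j\<le>s. w i j * b (Suc i) j) \<le>
        (\<Sum>i\<le>s. \<Sum>j\<le>s. (if i = p then if j = 0 then - \<eta> * B else 0 else 0)
          + \<bar>w i j\<bar> * ((1 + 2 * real m) * E))"
      by (intro sum_mono term2)
    also have "\<dots> = - \<eta> * B + (1 + 2 * real m) * (\<Sum>i\<le>s. \<Sum>j\<le>s. \<bar>w i j\<bar>) * E"
      by (simp add: sum_delta2 m sum.distrib sum_distrib_left sum_distrib_right mult_ac)
    finally have part2: "(\<Sum>i\<le>s. \<Sum>j\<le>s. w i j * b (Suc i) j)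
      \<le> - \<eta> * B + (1 + 2 * real m) * (\<Sum>i\<le>s. \<Sum>j\<le>s. \<bar>w i j\<bar>) * E" .
    have "C * E = C * \<epsilon> * G + C * \<epsilon> * B" by (simp add: E_def algebra_simps)
    also have "\<dots> \<le> \<kappa> * G + \<eta> * B"
      using \<epsilon>C G B by (intro add_mono mult_right_mono)
    finally show ?thesis
      unfolding main using part1 part2 by (simp add: C_def algebra_simps)
  qed
  then show ?thesis using \<epsilon>(1) by (intro exI[of _ \<epsilon>]) blast
qed

text \<open>Without dissipation only the defect sum is left. Its entry at i = p, j = 0 is known
  exactly, as m sign-changing shifts turn b(2m, 0) into (-1)^m b(m, m). Every other nonzero entry
  has total order at least p + 2 and goes into the term with C. The sign of the defect is left
  open.\<close>

lemma energy_skew_lower_bound: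
  assumes RK: "explicit_RK s \<alpha>" and ord: "has_linear_order \<alpha> p" and p: "Suc p = 2 * m"
  shows "\<exists>C. \<forall>b \<tau>. 0 < \<tau> \<longrightarrow> \<tau> \<le> 1 \<longrightarrow> (\<forall>i j. b i j = b j i) \<longrightarrow>
    (\<forall>i j. b (Suc i) j + b i (Suc j) = 0) \<longrightarrow> (\<forall>i. b i i = \<tau> ^ (2 * i)) \<longrightarrow>
    (\<forall>i j. \<bar>b i j\<bar> \<le> \<tau> ^ (i + j)) \<longrightarrow>
    1 + (2 * ((- 1) ^ m * (\<alpha> (Suc p) - 1 / fact (Suc p))) - C * \<tau>) * \<tau> ^ Suc p
      \<le> (\<Sum>i\<le>s. \<Sum>j\<le>s. \<alpha> i * \<alpha> j * b i j)"
proof -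
  define w where "w i j = 2 * (real (Suc i) * \<alpha> (Suc i) - \<alpha> i) * \<alpha> j / real (i + j + 1)" for i j
  define \<eta> where "\<eta> = 2 * ((- 1) ^ m * (\<alpha> (Suc p) - 1 / fact (Suc p)))"
  define C where "C = (\<Sum>i\<le>s. \<Sum>j\<le>s. \<bar>w i j\<bar>)"
  have ps: "p \<le> s" by (rule linear_order_le_stages[OF RK ord])
  have \<alpha>: "\<alpha> 0 = 1" "\<alpha> (Suc s) = 0" using RK by (auto simp: explicit_RK_def)
  have wp: "w p 0 = 2 * (\<alpha> (Suc p) - 1 / fact (Suc p))"
    unfolding w_def linear_order_defect(2)[OF ord] by (simp add: \<alpha> del: of_nat_Suc fact_Suc)
  have "1 + (\<eta> - C * \<tau>) * \<tau> ^ Suc p \<le> (\<Sum>i\<le>s. \<Sum>j\<le>s. \<alpha> i * \<alpha> j * b i j)"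
    if \<tau>: "0 < \<tau>" "\<tau> \<le> 1" and sym: "\<And>i j. b i j = b j i" and skew: "\<And>i j. b (Suc i) j + b i (Suc j) = 0"
      and diag: "\<And>i. b i i = \<tau> ^ (2 * i)" and bnd: "\<And>i j. \<bar>b i j\<bar> \<le> \<tau> ^ (i + j)"
    for b :: "nat \<Rightarrow> nat \<Rightarrow> real" and \<tau> :: real
  proof -
    have main: "(\<Sum>i\<le>s. \<Sum>j\<le>s. \<alpha> i * \<alpha> j * b i j) = 1 + (\<Sum>i\<le>s. \<Sum>j\<le>s. w i j * b (Suc i) j)"
      using energy_identity[of b \<alpha> s, OF sym \<alpha>(2)] diag[of 0]
      by (simp add: skew w_def \<alpha>(1) del: of_nat_Suc)
    have lead: "b (Suc p) 0 = (- 1) ^ m * \<tau> ^ Suc p"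
      using kernel_shift[of b "\<lambda>_ _. 0" m m 0] skew diag[of m] p by (simp add: mult_2)
    have "(if i = p then if j = 0 then \<eta> * \<tau> ^ Suc p else 0 else 0) - \<bar>w i j\<bar> * (\<tau> * \<tau> ^ Suc p)
        \<le> w i j * b (Suc i) j" for i j
    proof (cases "i = p \<and> j = 0")
      case True
      have "w p 0 * b (Suc p) 0 = \<eta> * \<tau> ^ Suc p"
        unfolding wp lead by (simp add: \<eta>_def del: fact_Suc)
      then show ?thesis using True \<tau> by simp
    next
      case False
      show ?thesis
      proof (cases "i < p")
        case True
        then show ?thesis using linear_order_defect(1)[OF ord True] by (simp add: w_def del: of_nat_Suc)
      next
        case False
        then have "Suc (Suc p) \<le> Suc i + j" using \<open>\<not> (i = p \<and> j = 0)\<close> by auto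
        then have "\<bar>b (Suc i) j\<bar> \<le> \<tau> ^ Suc (Suc p)"
          using bnd[of "Suc i" j] \<tau> power_decreasing[of "Suc (Suc p)" "Suc i + j" \<tau>] by linarith
        then have "- (w i j * b (Suc i) j) \<le> \<bar>w i j\<bar> * (\<tau> * \<tau> ^ Suc p)"
          using mult_le_abs_bound[of "- b (Suc i) j" _ "w i j"] by simp
        then show ?thesis using \<open>\<not> (i = p \<and> j = 0)\<close> by auto
      qed
    qed
    then have "(\<Sum>i\<le>s. \<Sum>j\<le>s. (if i = p then if j = 0 then \<eta> * \<tau> ^ Suc p else 0 else 0)
        - \<bar>w i j\<bar> * (\<tau> * \<tau> ^ Suc p)) \<le> (\<Sum>i\<le>s. \<Sum>j\<le>s. w i j * b (Suc i) j)"
      by (intro sum_mono)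
    moreover have "(\<Sum>i\<le>s. \<Sum>j\<le>s. (if i = p then if j = 0 then \<eta> * \<tau> ^ Suc p else 0 else 0)
        - \<bar>w i j\<bar> * (\<tau> * \<tau> ^ Suc p)) = (\<eta> - C * \<tau>) * \<tau> ^ Suc p"
      by (simp add: sum_delta2 ps sum_subtractf C_def sum_distrib_right left_diff_distrib mult.assoc)
    ultimately show ?thesis by (simp add: main)
  qed
  then show ?thesis unfolding \<eta>_def by blast
qed

subsection \<open>Weighted norms and stability matrices\<close>

lemma scalar_prod_mult_mat_vec:
  fixes v w :: "real vec"
  assumes "M \<in> carrier_mat N N" "v \<in> carrier_vec N" "w \<in> carrier_vec N"
  shows "v \<bullet> (M *\<^sub>v w) = (\<Sum>i<N. \<Sum>j<N. v $ i * w $ j * M $$ (i, j))"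
  using assms
  by (auto simp: scalar_prod_def mult_mat_vec_def atLeast0LessThan sum_distrib_left mult_ac intro!: sum.cong)

text \<open>The combination is given entrywise, the form in which \<open>RK_matrix\<close> acts on a
  vector. The index set is general: \<open>{..<n}\<close> serves the positivity of kernels,
  \<open>{..s}\<close> the energy of the method.\<close>

lemma bilinear_lincomb:
  fixes u :: "nat \<Rightarrow> real vec"
  assumes "M \<in> carrier_mat N N" "\<And>k. u k \<in> carrier_vec N"
  defines "v \<equiv> \<lambda>K c. vec N (\<lambda>i. \<Sum>k\<in>K. c k * u k $ i)"
  shows "v K c \<bullet> (M *\<^sub>v v K c) = (\<Sum>k\<in>K. \<Sum>l\<in>K. c k * c l * (u k \<bullet> (M *\<^sub>v u l)))"
proof -
  have "v K c \<bullet> (M *\<^sub>v v K c) = (\<Sum>i<N. \<Sum>j<N. \<Sum>k\<in>K. \<Sum>l\<in>K. c k * c l * (u k $ i * u l $ j * M $$ (i, j)))"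
  proof -
    have "v K c $ i * v K c $ j * M $$ (i, j) =
        (\<Sum>k\<in>K. \<Sum>l\<in>K. c k * c l * (u k $ i * u l $ j * M $$ (i, j)))" if "i < N" "j < N" for i j
    proof -
      have "v K c $ i * v K c $ j * M $$ (i, j) =
          (\<Sum>k\<in>K. c k * u k $ i) * (\<Sum>l\<in>K. c l * u l $ j) * M $$ (i, j)"
        using that by (simp add: v_def)
      also have "\<dots> = (\<Sum>k\<in>K. \<Sum>l\<in>K. c k * u k $ i * (c l * u l $ j) * M $$ (i, j))"
        by (subst sum_product) (simp only: sum_distrib_right)
      finally show ?thesis by (simp add: mult_ac)
    qed
    moreover have "v K c \<in> carrier_vec N" by (simp add: v_def)
    ultimately show ?thesis
      using assms(1) by (simp add: scalar_prod_mult_mat_vec[of M N])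
  qed
  also have "\<dots> = (\<Sum>i<N. \<Sum>k\<in>K. \<Sum>j<N. \<Sum>l\<in>K. c k * c l * (u k $ i * u l $ j * M $$ (i, j)))"
    by (rule sum.cong[OF refl], rule sum.swap)
  also have "\<dots> = (\<Sum>k\<in>K. \<Sum>i<N. \<Sum>j<N. \<Sum>l\<in>K. c k * c l * (u k $ i * u l $ j * M $$ (i, j)))"
    by (rule sum.swap)
  also have "\<dots> = (\<Sum>k\<in>K. \<Sum>i<N. \<Sum>l\<in>K. \<Sum>j<N. c k * c l * (u k $ i * u l $ j * M $$ (i, j)))"
    by (rule sum.cong[OF refl], rule sum.cong[OF refl], rule sum.swap)
  also have "\<dots> = (\<Sum>k\<in>K. \<Sum>l\<in>K. \<Sum>i<N. \<Sum>j<N. c k * c l * (u k $ i * u l $ j * M $$ (i, j)))"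
    by (rule sum.cong[OF refl], rule sum.swap)
  also have "\<dots> = (\<Sum>k\<in>K. \<Sum>l\<in>K. c k * c l * (u k \<bullet> (M *\<^sub>v u l)))"
    using assms(1,2) by (simp add: scalar_prod_mult_mat_vec[of M N] sum_distrib_left)
  finally show ?thesis .
qed

text \<open>The factor \<open>r\<close> lets one statement serve both kernels: \<open>r = 1\<close>
  with \<open>H\<close>, and a negative \<open>r\<close> with the negative semidefinite dissipation
  matrix.\<close>

lemma psd_kernel_bilinear:
  fixes u :: "nat \<Rightarrow> real vec"
  assumes "M \<in> carrier_mat N N" "\<And>k. u k \<in> carrier_vec N"
    and "\<And>v w. v \<in> carrier_vec N \<Longrightarrow> w \<in> carrier_vec N \<Longrightarrow> v \<bullet> (M *\<^sub>v w) = w \<bullet> (M *\<^sub>v v)"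
    and "\<And>v. v \<in> carrier_vec N \<Longrightarrow> 0 \<le> r * (v \<bullet> (M *\<^sub>v v))"
  shows "psd_kernel (\<lambda>i j. r * (u i \<bullet> (M *\<^sub>v u j)))"
  unfolding psd_kernel_def
proof (intro conjI allI)
  fix n and x :: "nat \<Rightarrow> real"
  have "(\<Sum>i<n. \<Sum>j<n. x i * x j * (r * (u i \<bullet> (M *\<^sub>v u j)))) =
      r * (\<Sum>i<n. \<Sum>j<n. x i * x j * (u i \<bullet> (M *\<^sub>v u j)))"
    by (simp add: sum_distrib_left mult_ac)
  also have "\<dots> \<ge> 0"
    unfolding bilinear_lincomb[OF assms(1,2), of x, symmetric] by (rule assms(4)) simp
  finally show "0 \<le> (\<Sum>i<n. \<Sum>j<n. x i * x j * (r * (u i \<bullet> (M *\<^sub>v u j))))" .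
qed (simp add: assms(2,3))

section \<open>Weighted inner products, norms and operator norms\<close>

lemma inner_H_commute:
  assumes "sym_pos_def N H" "v \<in> carrier_vec N" "w \<in> carrier_vec N"
  shows "inner_H H v w = inner_H H w v"
proof -
  have H: "H \<in> carrier_mat N N" "transpose_mat H = H" using assms by (auto simp: sym_pos_def_def)
  have "v \<bullet> (H *\<^sub>v w) = (H *\<^sub>v v) \<bullet> w"
    using transpose_vec_mult_scalar[OF H(1) assms(3,2)] H(2) by simp
  also have "\<dots> = w \<bullet> (H *\<^sub>v v)"
    using H assms by (intro comm_scalar_prod[of _ N]) auto
  finally show ?thesis by (simp add: inner_H_def)
qed

lemma inner_H_nonneg:
  assumes "sym_pos_def N H" "v \<in> carrier_vec N"
  shows "0 \<le> inner_H H v v"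
proof (cases "v = 0\<^sub>v N")
  case True
  then show ?thesis using assms by (auto simp: inner_H_def sym_pos_def_def)
next
  case False
  then show ?thesis using assms by (auto simp: inner_H_def sym_pos_def_def intro: less_imp_le)
qed

lemma norm_H_power2:
  assumes "sym_pos_def N H" "v \<in> carrier_vec N"
  shows "(norm_H H v)\<^sup>2 = inner_H H v v"
  using inner_H_nonneg[OF assms] by (simp add: norm_H_def)

lemma norm_H_nonneg:
  assumes "sym_pos_def N H" "v \<in> carrier_vec N"
  shows "0 \<le> norm_H H v"
  using inner_H_nonneg[OF assms] by (simp add: norm_H_def)

lemma inner_H_smult:
  assumes "H \<in> carrier_mat N N" "v \<in> carrier_vec N" "w \<in> carrier_vec N"
  shows "inner_H H (c \<cdot>\<^sub>v v) w = c * inner_H H v w" "inner_H H v (c \<cdot>\<^sub>v w) = c * inner_H H v w"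
proof -
  have Hw: "H *\<^sub>v w \<in> carrier_vec N" using assms by simp
  show "inner_H H (c \<cdot>\<^sub>v v) w = c * inner_H H v w"
    unfolding inner_H_def by (rule smult_scalar_prod_distrib[OF assms(2) Hw])
  show "inner_H H v (c \<cdot>\<^sub>v w) = c * inner_H H v w"
    unfolding inner_H_def mult_mat_vec[OF assms(1,3)]
    by (rule scalar_prod_smult_distrib[OF assms(2) Hw])
qed

lemma norm_H_smult:
  assumes "sym_pos_def N H" "v \<in> carrier_vec N"
  shows "norm_H H (c \<cdot>\<^sub>v v) = \<bar>c\<bar> * norm_H H v"
proof -
  have "H \<in> carrier_mat N N" using assms by (simp add: sym_pos_def_def)
  then have "inner_H H (c \<cdot>\<^sub>v v) (c \<cdot>\<^sub>v v) = c\<^sup>2 * inner_H H v v"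
    using assms by (simp add: inner_H_smult[of H N] power2_eq_square)
  then show ?thesis by (simp add: norm_H_def real_sqrt_mult)
qed

text \<open>Apply \<open>pos_def_kernel_coercive\<close> to the rank-one kernel
  \<open>v $ i * v $ j\<close>: its trace is the Euclidean square and its pairing with
  \<open>H\<close> the weighted one.\<close>

lemma inner_H_coercive:
  assumes "sym_pos_def N H"
  shows "\<exists>\<kappa>>0. \<forall>v\<in>carrier_vec N. \<kappa> * (\<Sum>i<N. (v $ i)\<^sup>2) \<le> inner_H H v v"
proof -
  have H: "H \<in> carrier_mat N N" "transpose_mat H = H" using assms by (auto simp: sym_pos_def_def)
  \<comment> \<open>Extended by zero because symmetry is demanded at all indices, while entries
    beyond the dimension carry no meaning.\<close>
  define A where "A i j = (if i < N \<and> j < N then H $$ (i, j) else 0)" for i j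
  have A: "(\<Sum>i<N. \<Sum>j<N. v $ i * v $ j * A i j) = inner_H H v v" if "v \<in> carrier_vec N" for v
    unfolding inner_H_def scalar_prod_mult_mat_vec[OF H(1) that that]
    by (intro sum.cong) (auto simp: A_def)
  have "\<exists>\<kappa>>0. \<forall>g. psd_kernel g \<longrightarrow> \<kappa> * (\<Sum>i<N. g i i) \<le> (\<Sum>i<N. \<Sum>j<N. A i j * g i j)"
  proof (rule pos_def_kernel_coercive)
    show "A i j = A j i" for i j
      using H by (metis A_def carrier_matD(1) carrier_matD(2) index_transpose_mat(1))
    fix x :: "nat \<Rightarrow> real"
    assume x: "\<exists>i<N. x i \<noteq> 0"
    then have "vec N x \<noteq> 0\<^sub>v N" by (metis index_vec index_zero_vec(1))
    then have "0 < inner_H H (vec N x) (vec N x)"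
      using assms by (simp add: sym_pos_def_def inner_H_def)
    then show "0 < (\<Sum>i<N. \<Sum>j<N. x i * x j * A i j)"
      by (simp add: A[symmetric])
  qed
  then obtain \<kappa> where \<kappa>: "\<kappa> > 0"
    "\<And>g. psd_kernel g \<Longrightarrow> \<kappa> * (\<Sum>i<N. g i i) \<le> (\<Sum>i<N. \<Sum>j<N. A i j * g i j)"
    by blast
  have "\<kappa> * (\<Sum>i<N. (v $ i)\<^sup>2) \<le> inner_H H v v" if "v \<in> carrier_vec N" for v
  proof -
    have "psd_kernel (\<lambda>i j. v $ i * v $ j)"
      unfolding psd_kernel_def
    proof (intro conjI allI)
      fix n and x :: "nat \<Rightarrow> real"
      have "(\<Sum>i<n. \<Sum>j<n. x i * x j * (v $ i * v $ j)) = (\<Sum>i<n. x i * v $ i)\<^sup>2"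
        by (simp add: power2_eq_square sum_product mult_ac)
      then show "0 \<le> (\<Sum>i<n. \<Sum>j<n. x i * x j * (v $ i * v $ j))" by simp
    qed simp
    from \<kappa>(2)[OF this] show ?thesis
      by (simp add: A[OF that, symmetric] power2_eq_square mult_ac)
  qed
  with \<kappa>(1) show ?thesis by blast
qed

text \<open>Gives meaning to the \<open>Sup\<close> in \<open>opnorm_H\<close>. Coordinates of
  vectors in the unit ball are bounded by \<open>inner_H_coercive\<close>, and the weighted square
  of L v is the quadratic form of L^T H L in these coordinates.\<close>

lemma opnorm_H_bdd_above:
  assumes H: "sym_pos_def N H" and L: "L \<in> carrier_mat N N"
  shows "bdd_above {norm_H H (L *\<^sub>v v) | v. v \<in> carrier_vec (dim_row H) \<and> norm_H H v \<le> 1}"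
proof -
  have Hc: "H \<in> carrier_mat N N" using H by (simp add: sym_pos_def_def)
  obtain \<kappa> where \<kappa>: "\<kappa> > 0" "\<And>v. v \<in> carrier_vec N \<Longrightarrow> \<kappa> * (\<Sum>i<N. (v $ i)\<^sup>2) \<le> inner_H H v v"
    using inner_H_coercive[OF H] by blast
  define M where "M = transpose_mat L * (H * L)"
  define K where "K = (\<Sum>i<N. \<Sum>j<N. \<bar>M $$ (i, j)\<bar> * (1 / \<kappa>))"
  have M: "M \<in> carrier_mat N N" using Hc L by (simp add: M_def)
  have "norm_H H (L *\<^sub>v v) \<le> sqrt K" if v: "v \<in> carrier_vec N" and "norm_H H v \<le> 1" for v
  proof -
    have "inner_H H v v \<le> 1"
      using norm_H_power2[OF H v] norm_H_nonneg[OF H v] \<open>norm_H H v \<le> 1\<close> by (metis power_le_one)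
    with \<kappa>(2)[OF v] \<kappa>(1) have le: "(\<Sum>i<N. (v $ i)\<^sup>2) \<le> 1 / \<kappa>" by (simp add: field_simps)
    have vv: "\<bar>v $ i * v $ j\<bar> \<le> 1 / \<kappa>" if "i < N" "j < N" for i j
    proof -
      have "(v $ k)\<^sup>2 \<le> 1 / \<kappa>" if "k < N" for k
        using le member_le_sum[of k "{..<N}" "\<lambda>i. (v $ i)\<^sup>2"] that by simp
      then have "(v $ i)\<^sup>2 \<le> 1 / \<kappa>" "(v $ j)\<^sup>2 \<le> 1 / \<kappa>" using that by auto
      moreover have "2 * \<bar>v $ i * v $ j\<bar> \<le> (v $ i)\<^sup>2 + (v $ j)\<^sup>2"
        using sum_squares_bound[of "\<bar>v $ i\<bar>" "\<bar>v $ j\<bar>"] by (simp add: abs_mult)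
      ultimately show ?thesis by simp
    qed
    have "inner_H H (L *\<^sub>v v) (L *\<^sub>v v) = v \<bullet> (M *\<^sub>v v)"
    proof -
      have "v \<bullet> (M *\<^sub>v v) = v \<bullet> (transpose_mat L *\<^sub>v (H *\<^sub>v (L *\<^sub>v v)))"
        using Hc L v by (simp add: M_def assoc_mult_mat_vec[of _ N N _ N])
      also have "\<dots> = (transpose_mat L *\<^sub>v (H *\<^sub>v (L *\<^sub>v v))) \<bullet> v"
        using Hc L v by (intro comm_scalar_prod[of _ N]) auto
      also have "\<dots> = (H *\<^sub>v (L *\<^sub>v v)) \<bullet> (L *\<^sub>v v)"
        using Hc L v by (intro transpose_vec_mult_scalar[of _ N N]) auto
      also have "\<dots> = (L *\<^sub>v v) \<bullet> (H *\<^sub>v (L *\<^sub>v v))"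
        using Hc L v by (intro comm_scalar_prod[of _ N]) auto
      finally show ?thesis by (simp add: inner_H_def)
    qed
    also have "\<dots> = (\<Sum>i<N. \<Sum>j<N. M $$ (i, j) * (v $ i * v $ j))"
      using scalar_prod_mult_mat_vec[OF M v v] by (simp add: mult.commute)
    also have "\<dots> \<le> K"
      unfolding K_def by (intro sum_mono mult_le_abs_bound vv) auto
    finally show ?thesis by (simp add: norm_H_def)
  qed
  then show ?thesis
    using Hc by (intro bdd_aboveI[of _ "sqrt K"]) auto
qed

lemma opnorm_H_upper:
  assumes H: "sym_pos_def N H" and L: "L \<in> carrier_mat N N" and v: "v \<in> carrier_vec N"
  shows "norm_H H (L *\<^sub>v v) \<le> opnorm_H H L * norm_H H v"
proof (cases "v = 0\<^sub>v N")
  case True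
  have "L *\<^sub>v 0\<^sub>v N = 0\<^sub>v N" using L by auto
  moreover have "norm_H H (0\<^sub>v N) = 0" using H by (auto simp: norm_H_def inner_H_def sym_pos_def_def)
  ultimately show ?thesis using True by simp
next
  case False
  define r where "r = norm_H H v"
  have "r > 0" using False H v by (auto simp: r_def norm_H_def inner_H_def sym_pos_def_def)
  then have "norm_H H ((1 / r) \<cdot>\<^sub>v v) = 1"
    using norm_H_smult[OF H v, of "1 / r"] by (simp add: r_def)
  then have "norm_H H (L *\<^sub>v ((1 / r) \<cdot>\<^sub>v v)) \<le> opnorm_H H L"
    unfolding opnorm_H_def using H v
    by (intro cSup_upper opnorm_H_bdd_above[OF H L]) (auto simp: sym_pos_def_def intro!: exI)
  moreover have "norm_H H (L *\<^sub>v ((1 / r) \<cdot>\<^sub>v v)) = 1 / r * norm_H H (L *\<^sub>v v)"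
    using L v \<open>r > 0\<close> norm_H_smult[OF H, of "L *\<^sub>v v" "1 / r"] by (simp add: mult_mat_vec[OF L v])
  ultimately show ?thesis using \<open>r > 0\<close> by (simp add: r_def[symmetric] field_simps)
qed

lemma opnorm_H_le:
  assumes H: "sym_pos_def N H" and "0 \<le> K"
    and K: "\<And>v. v \<in> carrier_vec N \<Longrightarrow> norm_H H (L *\<^sub>v v) \<le> K * norm_H H v"
  shows "opnorm_H H L \<le> K"
  unfolding opnorm_H_def
proof (rule cSup_least)
  have dim: "dim_row H = N" using H by (auto simp: sym_pos_def_def)
  have "norm_H H (0\<^sub>v N) = 0" using H by (auto simp: norm_H_def inner_H_def sym_pos_def_def)
  then show "{norm_H H (L *\<^sub>v v) |v. v \<in> carrier_vec (dim_row H) \<and> norm_H H v \<le> 1} \<noteq> {}"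
    using dim by (auto intro!: exI[of _ "0\<^sub>v N"])
  fix x
  assume "x \<in> {norm_H H (L *\<^sub>v v) |v. v \<in> carrier_vec (dim_row H) \<and> norm_H H v \<le> 1}"
  then obtain v where v: "x = norm_H H (L *\<^sub>v v)" "v \<in> carrier_vec N" "norm_H H v \<le> 1"
    using dim by auto
  have "x \<le> K * norm_H H v" using K v by simp
  also have "\<dots> \<le> K * 1" using v \<open>0 \<le> K\<close> by (intro mult_left_mono)
  finally show "x \<le> K" by simp
qed

section \<open>Action of the stability matrix on vectors\<close>

lemma RK_matrix_mult_vec:
  assumes L: "L \<in> carrier_mat N N" and v: "v \<in> carrier_vec N"
  shows "RK_matrix s \<alpha> N \<tau> L *\<^sub>v v = vec N (\<lambda>i. \<Sum>k\<in>{..s}. \<alpha> k * (((\<tau> \<cdot>\<^sub>m L) ^\<^sub>m k) *\<^sub>v v) $ i)"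
proof (rule eq_vecI)
  fix i
  assume "i < dim_vec (vec N (\<lambda>i. \<Sum>k\<in>{..s}. \<alpha> k * (((\<tau> \<cdot>\<^sub>m L) ^\<^sub>m k) *\<^sub>v v) $ i))"
  then have i: "i < N" by simp
  have P: "(\<tau> \<cdot>\<^sub>m L) ^\<^sub>m k \<in> carrier_mat N N" for k using L by simp
  have "(RK_matrix s \<alpha> N \<tau> L *\<^sub>v v) $ i
      = (\<Sum>j<N. \<Sum>k\<le>s. \<alpha> k * ((\<tau> \<cdot>\<^sub>m L) ^\<^sub>m k) $$ (i, j) * v $ j)"
    using i v L by (simp add: RK_matrix_def scalar_prod_def atLeast0LessThan sum_distrib_right)
  also have "\<dots> = (\<Sum>k\<le>s. \<Sum>j<N. \<alpha> k * ((\<tau> \<cdot>\<^sub>m L) ^\<^sub>m k) $$ (i, j) * v $ j)"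
    by (rule sum.swap)
  also have "\<dots> = (\<Sum>k\<le>s. \<alpha> k * (((\<tau> \<cdot>\<^sub>m L) ^\<^sub>m k) *\<^sub>v v) $ i)"
    using i v L by (simp add: scalar_prod_def atLeast0LessThan sum_distrib_left mult.assoc)
  finally show "(RK_matrix s \<alpha> N \<tau> L *\<^sub>v v) $ i
      = vec N (\<lambda>i. \<Sum>k\<in>{..s}. \<alpha> k * (((\<tau> \<cdot>\<^sub>m L) ^\<^sub>m k) *\<^sub>v v) $ i) $ i"
    using i by simp
qed (simp add: RK_matrix_def)

text \<open>A power appends its new factor on the right, whereas the recursion for u_k needs it to
  act last; the power commutes with its base.\<close>

lemma pow_mat_Suc_mult_vec:
  assumes "A \<in> carrier_mat N N" "v \<in> carrier_vec N"
  shows "(A ^\<^sub>m Suc k) *\<^sub>v v = A *\<^sub>v ((A ^\<^sub>m k) *\<^sub>v v)"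
proof -
  have "A ^\<^sub>m k * A = A * A ^\<^sub>m k"
  proof (induction k)
    case (Suc k)
    have "A ^\<^sub>m Suc k * A = A * A ^\<^sub>m k * A" using Suc.IH by simp
    also have "\<dots> = A * A ^\<^sub>m Suc k"
      using assms(1) by (simp add: assoc_mult_mat[of _ N N _ N _ N])
    finally show ?case .
  qed (use assms(1) in simp)
  then show ?thesis using assms by (simp add: assoc_mult_mat_vec[of _ N N _ N])
qed

lemma pow_mat_smult_Suc_mult_vec:
  assumes L: "L \<in> carrier_mat N N" and v: "v \<in> carrier_vec N"
  shows "((\<tau> \<cdot>\<^sub>m L) ^\<^sub>m Suc k) *\<^sub>v v = \<tau> \<cdot>\<^sub>v (L *\<^sub>v (((\<tau> \<cdot>\<^sub>m L) ^\<^sub>m k) *\<^sub>v v))"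
proof -
  have "(\<tau> \<cdot>\<^sub>m L) *\<^sub>v w = \<tau> \<cdot>\<^sub>v (L *\<^sub>v w)" if "w \<in> carrier_vec N" for w
    using L that by (intro eq_vecI) (auto simp: scalar_prod_def sum_distrib_left mult.assoc)
  then show ?thesis
    using pow_mat_Suc_mult_vec[of "\<tau> \<cdot>\<^sub>m L" N v k] L v mult_mat_vec_carrier[of "(\<tau> \<cdot>\<^sub>m L) ^\<^sub>m k" N N v]
    by simp
qed

lemma RK_matrix_inner:
  assumes "H \<in> carrier_mat N N" "L \<in> carrier_mat N N" "v \<in> carrier_vec N"
  shows "inner_H H (RK_matrix s \<alpha> N \<tau> L *\<^sub>v v) (RK_matrix s \<alpha> N \<tau> L *\<^sub>v v) =
    (\<Sum>i\<le>s. \<Sum>j\<le>s. \<alpha> i * \<alpha> j * inner_H H ((\<tau> \<cdot>\<^sub>m L) ^\<^sub>m i *\<^sub>v v) ((\<tau> \<cdot>\<^sub>m L) ^\<^sub>m j *\<^sub>v v))"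
  unfolding inner_H_def RK_matrix_mult_vec[OF assms(2,3)]
  using assms by (intro bilinear_lincomb mult_mat_vec_carrier[of _ N N] pow_carrier_mat) auto

text \<open>The polarised dissipation: at v = u_i, w = u_j and scaled by \<tau> it is b(i+1,j) +
  b(i,j+1), the source of the kernel relation. It also shows the symmetry of the dissipation
  form.\<close>

lemma dissipation_eq:
  assumes H: "sym_pos_def N H" and L: "L \<in> carrier_mat N N"
    and v: "v \<in> carrier_vec N" and w: "w \<in> carrier_vec N"
  shows "v \<bullet> ((transpose_mat L * H + H * L) *\<^sub>v w) = inner_H H (L *\<^sub>v v) w + inner_H H v (L *\<^sub>v w)"
proof -
  have Hc: "H \<in> carrier_mat N N" using H by (simp add: sym_pos_def_def)
  have "v \<bullet> ((transpose_mat L * H + H * L) *\<^sub>v w) = v \<bullet> (transpose_mat L *\<^sub>v (H *\<^sub>v w)) + v \<bullet> (H *\<^sub>v (L *\<^sub>v w))"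
    using Hc L v w by (simp add: add_mult_distrib_mat_vec[of _ N N] assoc_mult_mat_vec[of _ N N _ N]
        scalar_prod_add_distrib[of _ N])
  also have "v \<bullet> (transpose_mat L *\<^sub>v (H *\<^sub>v w)) = (transpose_mat L *\<^sub>v (H *\<^sub>v w)) \<bullet> v"
    using Hc L v w by (intro comm_scalar_prod[of _ N]) auto
  also have "\<dots> = (H *\<^sub>v w) \<bullet> (L *\<^sub>v v)"
    using Hc L v w by (intro transpose_vec_mult_scalar[of _ N N]) auto
  also have "\<dots> = (L *\<^sub>v v) \<bullet> (H *\<^sub>v w)"
    using Hc L v w by (intro comm_scalar_prod[of _ N]) auto
  finally show ?thesis by (simp add: inner_H_def)
qed

subsection \<open>Strong stability\<close>

lemma strongly_stable_if_negative_defect: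
  assumes RK: "explicit_RK s \<alpha>" and ord: "has_linear_order \<alpha> p" and p: "Suc p = 2 * m"
    and neg: "(- 1) ^ m * (\<alpha> (Suc p) - 1 / fact (Suc p)) < 0"
  shows "strongly_stable s \<alpha>"
proof -
  obtain \<epsilon> where "\<epsilon> > 0" and decay: "\<And>b g. psd_kernel b \<Longrightarrow> psd_kernel g \<Longrightarrow>
      (\<And>i j. b (Suc i) j + b i (Suc j) = - g i j) \<Longrightarrow> (\<And>i. b (Suc i) (Suc i) \<le> \<epsilon> ^ 4 * b i i) \<Longrightarrow>
      (\<Sum>i\<le>s. \<Sum>j\<le>s. \<alpha> i * \<alpha> j * b i j) \<le> b 0 0"
    using energy_decay[OF assms] by blast
  have "opnorm_H H (RK_matrix s \<alpha> N \<tau> L) \<le> 1"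
    if H: "sym_pos_def N H" and neg: "semi_negative N H L" and \<tau>: "\<tau> > 0" and le: "\<tau> * opnorm_H H L \<le> \<epsilon>\<^sup>2"
    for N H L \<tau>
  proof (rule opnorm_H_le[OF H])
    fix v :: "real vec"
    assume v: "v \<in> carrier_vec N"
    have L: "L \<in> carrier_mat N N"
      and diss: "\<And>x. x \<in> carrier_vec N \<Longrightarrow> x \<bullet> ((transpose_mat L * H + H * L) *\<^sub>v x) \<le> 0"
      using neg by (auto simp: semi_negative_def neg_semidef_def)
    have Hc: "H \<in> carrier_mat N N" using H by (simp add: sym_pos_def_def)
    define u where "u k = ((\<tau> \<cdot>\<^sub>m L) ^\<^sub>m k) *\<^sub>v v" for k
    have u: "u k \<in> carrier_vec N" for k
      unfolding u_def using L v by (intro mult_mat_vec_carrier[of _ N N] pow_carrier_mat) auto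
    have Lu: "L *\<^sub>v u k \<in> carrier_vec N" for k
      using L u by (intro mult_mat_vec_carrier[of _ N N])
    have u_Suc: "u (Suc k) = \<tau> \<cdot>\<^sub>v (L *\<^sub>v u k)" for k
      unfolding u_def by (rule pow_mat_smult_Suc_mult_vec[OF L v])
    have u0: "u 0 = v" using L v by (simp add: u_def)
    have "(\<Sum>i\<le>s. \<Sum>j\<le>s. \<alpha> i * \<alpha> j * inner_H H (u i) (u j)) \<le> inner_H H (u 0) (u 0)"
    proof (rule decay)
      have "psd_kernel (\<lambda>i j. 1 * (u i \<bullet> (H *\<^sub>v u j)))"
        using inner_H_commute[OF H] inner_H_nonneg[OF H]
        by (intro psd_kernel_bilinear[OF Hc u]) (simp_all add: inner_H_def)
      then show "psd_kernel (\<lambda>i j. inner_H H (u i) (u j))" by (simp add: inner_H_def)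
      \<comment> \<open>The minus sign makes the negative semidefinite form a positive kernel;
        \<tau> matches the step contained in \<open>u (Suc k)\<close>.\<close>
      show "psd_kernel (\<lambda>i j. - \<tau> * (u i \<bullet> ((transpose_mat L * H + H * L) *\<^sub>v u j)))"
      proof (rule psd_kernel_bilinear[OF _ u])
        show "transpose_mat L * H + H * L \<in> carrier_mat N N" using L Hc by simp
        show "0 \<le> - \<tau> * (x \<bullet> ((transpose_mat L * H + H * L) *\<^sub>v x))" if "x \<in> carrier_vec N" for x
          using diss[OF that] \<tau> by (simp add: mult_le_0_iff)
        fix x y :: "real vec"
        assume xy: "x \<in> carrier_vec N" "y \<in> carrier_vec N"
        then show "x \<bullet> ((transpose_mat L * H + H * L) *\<^sub>v y) = y \<bullet> ((transpose_mat L * H + H * L) *\<^sub>v x)"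
          using L by (simp add: dissipation_eq[OF H L] inner_H_commute[OF H, of "L *\<^sub>v x" y]
              inner_H_commute[OF H, of x "L *\<^sub>v y"])
      qed
      show "inner_H H (u (Suc i)) (u j) + inner_H H (u i) (u (Suc j)) =
          - (- \<tau> * (u i \<bullet> ((transpose_mat L * H + H * L) *\<^sub>v u j)))" for i j
        using u Lu by (simp add: u_Suc inner_H_smult[OF Hc] dissipation_eq[OF H L] distrib_left)
      show "inner_H H (u (Suc i)) (u (Suc i)) \<le> \<epsilon> ^ 4 * inner_H H (u i) (u i)" for i
      proof -
        have "norm_H H (u (Suc i)) = \<tau> * norm_H H (L *\<^sub>v u i)"
          using \<tau> by (simp add: u_Suc norm_H_smult[OF H Lu])
        also have "\<dots> \<le> \<tau> * (opnorm_H H L * norm_H H (u i))"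
          using opnorm_H_upper[OF H L u] \<tau> by (intro mult_left_mono) auto
        also have "\<dots> \<le> \<epsilon>\<^sup>2 * norm_H H (u i)"
          using mult_right_mono[OF le norm_H_nonneg[OF H u]] by (simp add: mult.assoc)
        finally have "(norm_H H (u (Suc i)))\<^sup>2 \<le> (\<epsilon>\<^sup>2 * norm_H H (u i))\<^sup>2"
          using norm_H_nonneg[OF H u] by (intro power_mono)
        then show ?thesis by (simp add: power_mult_distrib norm_H_power2[OF H u])
      qed
    qed
    then show "norm_H H (RK_matrix s \<alpha> N \<tau> L *\<^sub>v v) \<le> 1 * norm_H H v"
      unfolding norm_H_def RK_matrix_inner[OF Hc L v] u_def[symmetric] u0 by simp
  qed simp
  \<comment> \<open>The witness is the square of \<epsilon>, as the norm bound is squared once more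
    to reach \<open>\<epsilon> ^ 4\<close>.\<close>
  then show ?thesis
    unfolding strongly_stable_def using \<open>\<epsilon> > 0\<close> by (intro exI[of _ "\<epsilon>\<^sup>2"]) simp
qed

section \<open>The right-angle rotation of the plane\<close>

definition rot90 :: "real mat" where
  "rot90 = mat 2 2 (\<lambda>(i, j). if i < j then - 1 else if j < i then 1 else 0)"

lemma rot90_carrier: "rot90 \<in> carrier_mat 2 2"
  by (simp add: rot90_def)

lemma sym_pos_def_one: "sym_pos_def N (1\<^sub>m N)"
  unfolding sym_pos_def_def
proof (intro conjI ballI impI)
  fix v :: "real vec"
  assume v: "v \<in> carrier_vec N" "v \<noteq> 0\<^sub>v N"
  then obtain i where i: "i < N" "v $ i \<noteq> 0" by (metis carrier_vecD eq_vecI index_zero_vec)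
  have "0 < (v $ i)\<^sup>2" using i by simp
  also have "\<dots> \<le> (\<Sum>j<N. (v $ j)\<^sup>2)" using i by (intro member_le_sum) auto
  finally show "0 < v \<bullet> (1\<^sub>m N *\<^sub>v v)"
    using v by (simp add: scalar_prod_def atLeast0LessThan power2_eq_square)
qed auto

lemma inner_H_one_2:
  assumes "v \<in> carrier_vec 2" "w \<in> carrier_vec 2"
  shows "inner_H (1\<^sub>m 2) v w = v $ 0 * w $ 0 + v $ Suc 0 * w $ Suc 0"
  using assms by (simp add: inner_H_def scalar_prod_def numeral_2_eq_2)

lemma rot90_mult_vec:
  assumes "v \<in> carrier_vec 2"
  shows "(rot90 *\<^sub>v v) $ 0 = - v $ Suc 0" "(rot90 *\<^sub>v v) $ Suc 0 = v $ 0" "rot90 *\<^sub>v v \<in> carrier_vec 2"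
  using assms mult_mat_vec_carrier[OF rot90_carrier assms]
  by (simp_all add: rot90_def scalar_prod_def numeral_2_eq_2)

text \<open>Isometry gives |u_k| = \<tau>^k exactly and operator norm at most 1; skewness removes
  the dissipation.\<close>

lemma rot90_isometry:
  assumes "v \<in> carrier_vec 2" "w \<in> carrier_vec 2"
  shows "inner_H (1\<^sub>m 2) (rot90 *\<^sub>v v) (rot90 *\<^sub>v w) = inner_H (1\<^sub>m 2) v w"
    and "inner_H (1\<^sub>m 2) (rot90 *\<^sub>v v) w + inner_H (1\<^sub>m 2) v (rot90 *\<^sub>v w) = 0"
  using assms by (simp_all add: inner_H_one_2 rot90_mult_vec)

lemma not_strongly_stable_if_positive_defect:
  assumes RK: "explicit_RK s \<alpha>" and ord: "has_linear_order \<alpha> p" and p: "Suc p = 2 * m"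
    and pos: "(- 1) ^ m * (\<alpha> (Suc p) - 1 / fact (Suc p)) > 0"
  shows "\<not> strongly_stable s \<alpha>"
proof
  assume "strongly_stable s \<alpha>"
  then obtain c where "c > 0" and stable: "\<And>N H L \<tau>. sym_pos_def N H \<Longrightarrow> semi_negative N H L \<Longrightarrow>
      \<tau> > 0 \<Longrightarrow> \<tau> * opnorm_H H L \<le> c \<Longrightarrow> opnorm_H H (RK_matrix s \<alpha> N \<tau> L) \<le> 1"
    unfolding strongly_stable_def by blast
  define \<delta> where "\<delta> = (- 1) ^ m * (\<alpha> (Suc p) - 1 / fact (Suc p))"
  have \<delta>: "\<delta> > 0" using pos by (simp add: \<delta>_def)
  obtain C where lower: "\<And>b \<tau>. 0 < \<tau> \<Longrightarrow> \<tau> \<le> 1 \<Longrightarrow> (\<And>i j. b i j = b j i) \<Longrightarrow>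
      (\<And>i j. b (Suc i) j + b i (Suc j) = 0) \<Longrightarrow> (\<And>i. b i i = \<tau> ^ (2 * i)) \<Longrightarrow>
      (\<And>i j. \<bar>b i j\<bar> \<le> \<tau> ^ (i + j)) \<Longrightarrow>
      1 + (2 * \<delta> - C * \<tau>) * \<tau> ^ Suc p \<le> (\<Sum>i\<le>s. \<Sum>j\<le>s. \<alpha> i * \<alpha> j * b i j)"
    using energy_skew_lower_bound[OF RK ord p] unfolding \<delta>_def by blast
  \<comment> \<open>\<open>\<tau> \<le> c\<close> makes the step admissible, as the rotation has
    norm at most 1. The last bound yields \<open>C * \<tau> \<le> \<delta>\<close>, so that
    \<open>2 * \<delta> - C * \<tau>\<close> stays at least \<delta>; the absolute value covers
    either sign of \<open>C\<close>.\<close>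
  define \<tau> where "\<tau> = min 1 (min c (\<delta> / (1 + \<bar>C\<bar>)))"
  have \<tau>: "0 < \<tau>" "\<tau> \<le> 1" "\<tau> \<le> c" "\<tau> \<le> \<delta> / (1 + \<bar>C\<bar>)"
    using \<delta> \<open>c > 0\<close> by (auto simp: \<tau>_def)
  have "C * \<tau> \<le> (1 + \<bar>C\<bar>) * \<tau>" using \<tau>(1) by (intro mult_right_mono) auto
  also have "\<dots> \<le> \<delta>" using \<tau>(4) by (simp add: field_simps)
  finally have C\<tau>: "C * \<tau> \<le> \<delta>" .
  let ?H = "1\<^sub>m 2 :: real mat" and ?R = "RK_matrix s \<alpha> 2 \<tau> rot90"
  have H: "sym_pos_def 2 ?H" by (rule sym_pos_def_one)
  have "semi_negative 2 ?H rot90"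
    unfolding semi_negative_def neg_semidef_def
  proof (intro conjI ballI rot90_carrier)
    show "transpose_mat rot90 * ?H + ?H * rot90 \<in> carrier_mat 2 2"
      using rot90_carrier by simp
    show "x \<bullet> ((transpose_mat rot90 * ?H + ?H * rot90) *\<^sub>v x) \<le> 0" if "x \<in> carrier_vec 2" for x
      using rot90_isometry(2)[OF that that] dissipation_eq[OF H rot90_carrier that that] by linarith
  qed
  moreover have "opnorm_H ?H rot90 \<le> 1"
    by (rule opnorm_H_le[OF H]) (simp_all add: norm_H_def rot90_isometry(1))
  then have "\<tau> * opnorm_H ?H rot90 \<le> c"
    using \<tau> mult_left_le[of "opnorm_H ?H rot90" \<tau>] by linarith
  ultimately have R: "opnorm_H ?H ?R \<le> 1"
    using stable[OF H] \<tau>(1) by blast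
  define v where "v = (unit_vec 2 0 :: real vec)"
  have v: "v \<in> carrier_vec 2" by (simp add: v_def)
  define u where "u k = ((\<tau> \<cdot>\<^sub>m rot90) ^\<^sub>m k) *\<^sub>v v" for k
  have u: "u k \<in> carrier_vec 2" for k
    unfolding u_def using rot90_carrier v by (intro mult_mat_vec_carrier[of _ 2 2] pow_carrier_mat) auto
  have u_Suc: "u (Suc k) = \<tau> \<cdot>\<^sub>v (rot90 *\<^sub>v u k)" for k
    unfolding u_def by (rule pow_mat_smult_Suc_mult_vec[OF rot90_carrier v])
  have u0: "u 0 = v" using rot90_carrier v by (simp add: u_def)
  have vv: "inner_H ?H v v = 1" using v by (simp add: inner_H_one_2) (simp add: v_def)
  define b where "b i j = inner_H ?H (u i) (u j)" for i j
  note smult = inner_H_smult[of ?H 2, OF one_carrier_mat]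
  have diag: "b i i = \<tau> ^ (2 * i)" for i
  proof (induction i)
    case 0
    show ?case by (simp add: b_def u0 vv)
  next
    case (Suc i)
    have "b (Suc i) (Suc i) = \<tau> * (\<tau> * b i i)"
      using u by (simp add: b_def u_Suc smult rot90_mult_vec(3) rot90_isometry(1))
    then show ?case using Suc.IH by simp
  qed
  have psd: "psd_kernel b"
  proof -
    have "psd_kernel (\<lambda>i j. 1 * (u i \<bullet> (?H *\<^sub>v u j)))"
      using inner_H_commute[OF H] inner_H_nonneg[OF H] unfolding inner_H_def
      by (intro psd_kernel_bilinear[OF one_carrier_mat u]) (simp_all only: mult_1)
    then show ?thesis by (simp add: b_def[abs_def] inner_H_def)
  qed
  have "1 + (2 * \<delta> - C * \<tau>) * \<tau> ^ Suc p \<le> (\<Sum>i\<le>s. \<Sum>j\<le>s. \<alpha> i * \<alpha> j * b i j)"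
  proof (rule lower)
    show "b i j = b j i" for i j by (rule psd_kernel_sym[OF psd])
    show "b (Suc i) j + b i (Suc j) = 0" for i j
      using u rot90_isometry(2)[OF u u, of i j]
      by (simp add: b_def u_Suc smult rot90_mult_vec(3) distrib_left[symmetric])
    show "\<bar>b i j\<bar> \<le> \<tau> ^ (i + j)" for i j
      using psd_kernel_cauchy_schwarz[OF psd, of "\<tau> ^ i" "\<tau> ^ j" i 1 j] \<tau>(1)
      by (simp add: diag power_mult[symmetric] power_add mult.commute)
  qed (use \<tau> diag in auto)
  also have "\<dots> = inner_H ?H (?R *\<^sub>v v) (?R *\<^sub>v v)"
    by (simp add: b_def u_def RK_matrix_inner[OF one_carrier_mat rot90_carrier v])
  also have "\<dots> \<le> 1"
  proof -
    have "norm_H ?H (?R *\<^sub>v v) \<le> opnorm_H ?H ?R * norm_H ?H v"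
      by (rule opnorm_H_upper[OF H _ v]) (simp add: RK_matrix_def)
    then have "norm_H ?H (?R *\<^sub>v v) \<le> 1"
      using R by (simp add: norm_H_def[of ?H v] vv)
    then show ?thesis by (simp add: norm_H_def)
  qed
  \<comment> \<open>The energy would be at most 1 and yet at least 1 + \<delta>
    \<tau>^(p+1).\<close>
  finally show False
    using C\<tau> \<delta> zero_less_power[OF \<tau>(1), of "Suc p"] by (simp add: mult_le_0_iff del: power_Suc)
qed

theorem theorem4p4:
  fixes s p :: nat and \<alpha> :: "nat \<Rightarrow> real"
  assumes "explicit_RK s \<alpha>"
    and "has_linear_order \<alpha> p"
    and "odd p"
  shows "strongly_stable s \<alpha> \<longleftrightarrow>
         (-1) ^ ((p + 1) div 2) * (\<alpha> (p + 1) - 1 / fact (p + 1)) < 0"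
proof -
  define m where "m = (p + 1) div 2"
  have p: "Suc p = 2 * m" using \<open>odd p\<close> by (simp add: m_def)
  \<comment> \<open>The order is exactly \<open>p\<close>, so the defect is nonzero and its two
    signs exhaust the cases.\<close>
  have "\<alpha> (Suc p) - 1 / fact (Suc p) \<noteq> 0"
    using assms(2) by (simp add: has_linear_order_def del: fact_Suc)
  then have "(- 1) ^ m * (\<alpha> (Suc p) - 1 / fact (Suc p)) \<noteq> 0" by (simp del: fact_Suc)
  then show ?thesis
    using strongly_stable_if_negative_defect[OF assms(1,2) p]
      not_strongly_stable_if_positive_defect[OF assms(1,2) p]
    unfolding m_def Suc_eq_plus1 by (meson linorder_neqE)
qed

end
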